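(* Let $n\ge 2$ be an integer and let $p,q$ be positive real numbers with $p\neq q$. Then there exists a unilateral lattice tiling of $\mathbb{R}^n$ by hypercubes of side lengths $p$ and $q$, and it is unique up to symmetries: any two unilateral lattice tilings of $\mathbb{R}^n$ by hypercubes of side lengths $p$ and $q$ are mapped onto each other by an isometry of $\mathbb{R}^n$.
   Context: A tiling of $\mathbb{R}^n$ is a family of closed sets (tiles) whose union is $\mathbb{R}^n$ and whose pairwise intersections have Lebesgue measure zero. All hypercubes are closed and axis-parallel. A lattice tiling of $\mathbb{R}^n$ by hypercubes of side lengths $p$ and $q$ is a tiling whose tiles are exactly the sets $S_0+\lambda$ and $T_0+\lambda$, $\lambda\in\Lambda$, where $\Lambda=B\mathbb{Z}^n$ for an invertible real $n\times n$ matrix $B$, $S_0$ is a hypercube of side length $p$ and $T_0$ is a hypercube of side length $q$ (so the centers of the tiles of each size form a translate of the lattice $\Lambda$). A tiling by hypercubes is unilateral if no two distinct tiles of the same side length share a full facet. *)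

theory Defs
  imports "HOL-Analysis.Analysis"
begin

definition is_hcube :: "real \<Rightarrow> (real ^ 'n) set \<Rightarrow> bool" where
  "is_hcube s C \<longleftrightarrow> s > 0 \<and> (\<exists>a. C = cbox a (a + s *\<^sub>R One))"

definition is_tiling :: "(real ^ 'n) set set \<Rightarrow> bool" where
  "is_tiling F \<longleftrightarrow> (\<forall>S\<in>F. closed S) \<and> \<Union>F = UNIV \<and>
     (\<forall>S\<in>F. \<forall>T\<in>F. S \<noteq> T \<longrightarrow> negligible (S \<inter> T))"

definition lattice_of :: "real ^ 'n ^ 'n \<Rightarrow> (real ^ 'n) set" where
  "lattice_of B = {B *v z | z. \<forall>i. z $ i \<in> \<int>}"

definition lattice_cube_tiling :: "real \<Rightarrow> real \<Rightarrow> (real ^ 'n) set set \<Rightarrow> bool" where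
  "lattice_cube_tiling p q F \<longleftrightarrow>
     (\<exists>B S0 T0. invertible B \<and> is_hcube p S0 \<and> is_hcube q T0 \<and>
        F = {(\<lambda>x. x + l) ` S0 | l. l \<in> lattice_of B} \<union> {(\<lambda>x. x + l) ` T0 | l. l \<in> lattice_of B} \<and>
        is_tiling F)"

definition unilateral :: "(real ^ 'n) set set \<Rightarrow> bool" where
  "unilateral F \<longleftrightarrow> (\<forall>S\<in>F. \<forall>T\<in>F. S \<noteq> T \<and> (\<exists>s. is_hcube s S \<and> is_hcube s T) \<longrightarrow>
       \<not> (\<exists>G. G facet_of S \<and> G facet_of T))"

end

theory Submission
  imports Defs
begin

text \<open>
  Let \<open>p < q\<close>. Big cubes cannot overlap, so every nonzero lattice vector has a coordinate of absolute value
  at least \<open>q\<close>; hence small cubes never touch each other, and a small cube is surrounded by big ones.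
  Two big cubes that continue the small cube \<open>T\<close> past adjacent facets at a common vertex can only be
  disjoint if one of them is flush with \<open>T\<close>. Following this around the four vertices of a
  two-dimensional face of \<open>T\<close> produces a pinwheel, so that each facet of \<open>T\<close> is covered by a single big
  cube, opposite big cubes are symmetric about the centre of \<open>T\<close>, and their positions are encoded by a
  tournament on the coordinates, up to reflections. A three-cycle of the tournament dominating a fourth
  coordinate would force a nonzero lattice vector that is too short, so after reflections and a permutation
  of the coordinates the tournament is a linear order. Then the lattice contains the vectors
  \<open>q e\<^sub>k - p e\<^bsub>k+1\<^esub>\<close> and \<open>q e\<^bsub>n-1\<^esub> + p e\<^sub>0\<close>. The cubes placed along these vectors already tile the space,
  so there is nothing else. Unilaterality turns out to be automatic: if \<open>q e\<^sub>i\<close> were in the lattice, a big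
  neighbour of \<open>T\<close> shifted by it would overlap \<open>T\<close>.
\<close>

section \<open>The model lattice in coordinates\<close>

text \<open>A cyclic shift that changes sign when it wraps around. It is polymorphic because it acts
  on integer coefficients in \<open>model_point\<close> and on real vectors in
  \<open>model_lattice_matrix\<close>.\<close>

definition twisted_shift :: "nat \<Rightarrow> (nat \<Rightarrow> 'a::ab_group_add) \<Rightarrow> nat \<Rightarrow> 'a" where
  "twisted_shift n a k = (if k = 0 then - a (n - 1) else a (k - 1))"

text \<open>The lattice vector with coefficients \<open>a\<close> in the basis
  \<open>q e_k - p e_(k+1)\<close>, closed up by \<open>q e_(n-1) + p e_0\<close>. The determinant
  of this basis is \<open>q^n + p^n\<close>, the joint volume of one small and one big cube.\<close>

definition model_point :: "real \<Rightarrow> real \<Rightarrow> nat \<Rightarrow> (nat \<Rightarrow> int) \<Rightarrow> nat \<Rightarrow> real" where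
  "model_point p q n a k = q * a k - p * twisted_shift n a k"

text \<open>The centre of the big cube that touches the small cube at the origin along its upper
  facet in direction 0 and is flush with its lower facets in all other directions.\<close>

definition model_offset :: "real \<Rightarrow> real \<Rightarrow> nat \<Rightarrow> real" where
  "model_offset p q k = (if k = 0 then (p + q) / 2 else (q - p) / 2)"

lemma model_point_diff:
  "model_point p q n (\<lambda>k. a k - b k) k = model_point p q n a k - model_point p q n b k"
  by (cases "k = 0") (simp_all add: model_point_def twisted_shift_def algebra_simps)

text \<open>Coordinates below \<open>q\<close> in absolute value force consecutive coefficients to
  have weakly the same sign and not to grow in absolute value. Around the cycle all absolute values
  agree, and the sign change at the wrap leaves only zero.\<close>

lemma model_point_sep:
  assumes p: "0 < p" "p < q" and nz: "k0 < n" "a k0 \<noteq> 0"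
  shows "\<exists>k<n. q \<le> \<bar>model_point p q n a k\<bar>"
proof (rule ccontr)
  assume "\<not> ?thesis"
  then have small: "\<bar>model_point p q n a k\<bar> < q" if "k < n" for k
    using that by force
  \<comment> \<open>If \<open>x\<close> is larger than \<open>y\<close> in absolute value, the
    difference is at least \<open>q * (\<bar>y\<bar> + 1) - p * \<bar>y\<bar>\<close>; if the signs
    are opposite, it is at least \<open>q + p\<close>.\<close>
  have gen: "\<bar>x\<bar> \<le> \<bar>y\<bar> \<and> 0 \<le> x * y" if "\<bar>q * of_int x - p * of_int y\<bar> < q" for x y :: int
  proof -
    have le: "\<bar>x\<bar> \<le> \<bar>y\<bar>"
    proof (rule ccontr)
      assume "\<not> \<bar>x\<bar> \<le> \<bar>y\<bar>"
      then have "real_of_int \<bar>x\<bar> \<ge> real_of_int \<bar>y\<bar> + 1" by linarith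
      then have "q * \<bar>real_of_int x\<bar> \<ge> q * \<bar>real_of_int y\<bar> + q"
        using p mult_left_mono[of "\<bar>real_of_int y\<bar> + 1" "\<bar>real_of_int x\<bar>" q] by (simp add: algebra_simps)
      moreover have "p * \<bar>real_of_int y\<bar> \<le> q * \<bar>real_of_int y\<bar>"
        using p by (intro mult_right_mono) auto
      moreover have "\<bar>q * real_of_int x\<bar> = q * \<bar>real_of_int x\<bar>" "\<bar>p * real_of_int y\<bar> = p * \<bar>real_of_int y\<bar>"
        using p by (auto simp: abs_mult)
      ultimately show False using that by linarith
    qed
    moreover have "0 \<le> x * y"
    proof (rule ccontr)
      assume "\<not> 0 \<le> x * y"
      then consider "x \<ge> 1" "y \<le> -1" | "x \<le> -1" "y \<ge> 1"
        by (smt (verit) mult_nonneg_nonneg mult_nonpos_nonpos)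
      then show False
      proof cases
        case 1
        have "q * 1 \<le> q * real_of_int x" "p * 1 \<le> p * (- real_of_int y)"
          using 1 p by (intro mult_left_mono; simp)+
        then show False using that p by linarith
      next
        case 2
        have "q * 1 \<le> q * (- real_of_int x)" "p * 1 \<le> p * real_of_int y"
          using 2 p by (intro mult_left_mono; simp)+
        then show False using that p by linarith
      qed
    qed
    ultimately show ?thesis by simp
  qed
  have step: "\<bar>a (Suc k)\<bar> \<le> \<bar>a k\<bar> \<and> 0 \<le> a (Suc k) * a k" if "Suc k < n" for k
    using gen[of "a (Suc k)" "a k"] small[OF that] by (simp add: model_point_def twisted_shift_def)
  have zero: "\<bar>a 0\<bar> \<le> \<bar>a (n - 1)\<bar> \<and> 0 \<le> - (a 0 * a (n - 1))"
    using gen[of "a 0" "- a (n - 1)"] small[of 0] nz by (simp add: model_point_def twisted_shift_def)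
  have mono: "j \<le> k \<Longrightarrow> k < n \<Longrightarrow> \<bar>a k\<bar> \<le> \<bar>a j\<bar>" for j k
    by (induction k rule: dec_induct) (use step in force)+
  have eq: "\<bar>a k\<bar> = \<bar>a 0\<bar>" if "k < n" for k
    using mono[of 0 k] mono[of k "n - 1"] zero that by force
  have pos: "k < n \<Longrightarrow> a k = a 0" for k
  proof (induction k)
    case (Suc k)
    then have "a k = a 0" by simp
    with step[of k] eq[of "Suc k"] Suc.prems show ?case
      by (smt (verit) mult_neg_pos mult_pos_neg)
  qed simp
  have "a 0 \<noteq> 0" using eq[OF nz(1)] nz(2) by auto
  moreover have "a (n - 1) = a 0" using pos[of "n - 1"] nz by simp
  ultimately show False using zero by (smt (verit) mult_neg_neg mult_pos_pos)
qed

text \<open>The inequalities at positive indices propagate the sign of \<open>a 0\<close>: the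
  entries are all nonnegative or all at most -1. Either case contradicts the two bounds at index 0,
  where the twist turns the difference into a sum.\<close>

lemma model_point_offset_sep:
  assumes p: "0 < p" "p < q" and n: "0 < n"
  shows "\<exists>k<n. (p + q) / 2 \<le> \<bar>model_point p q n a k + model_offset p q k\<bar>"
proof (rule ccontr)
  assume "\<not> ?thesis"
  then have small: "\<bar>model_point p q n a k + model_offset p q k\<bar> < (p + q) / 2" if "k < n" for k
    using that by force
  have zero: "- (p + q) < q * a 0 + p * a (n - 1)" "q * a 0 + p * a (n - 1) < 0"
    using small[of 0] n by (auto simp: model_point_def model_offset_def twisted_shift_def abs_less_iff field_simps)
  have suc: "- q < q * a (Suc k) - p * a k \<and> q * a (Suc k) - p * a k < p" if "Suc k < n" for k
    using small[OF that]
    by (auto simp: model_point_def model_offset_def twisted_shift_def abs_less_iff field_simps)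
  show False
  proof (cases "a 0 \<ge> 0")
    case True
    have "k < n \<Longrightarrow> 0 \<le> a k" for k
    proof (induction k)
      case (Suc k)
      have "0 \<le> p * a k" using Suc p by simp
      then have "q * (-1) < q * a (Suc k)" using suc[OF Suc.prems] by linarith
      then have "-1 < real_of_int (a (Suc k))" using p by (subst (asm) mult_less_cancel_left_pos) auto
      then show ?case by linarith
    qed (use True in simp)
    then have "0 \<le> q * a 0" "0 \<le> p * a (n - 1)" using p n by auto
    then show False using zero by linarith
  next
    case False
    have neg: "k < n \<Longrightarrow> a k \<le> -1" for k
    proof (induction k)
      case (Suc k)
      then have "real_of_int (a k) \<le> -1" by simp
      then have "p * a k \<le> p * (-1)" using p by (intro mult_left_mono) auto
      then have "q * a (Suc k) < q * 0" using suc[OF Suc.prems] by linarith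
      then have "real_of_int (a (Suc k)) < 0" using p by (subst (asm) mult_less_cancel_left_pos) auto
      then show ?case by linarith
    qed (use False in simp)
    have "real_of_int (a 0) \<le> -1" "real_of_int (a (n - 1)) \<le> -1" using neg[of 0] neg[of "n - 1"] n by auto
    then have "q * a 0 \<le> q * (-1)" "p * a (n - 1) \<le> p * (-1)" using p by (intro mult_left_mono; simp)+
    then show False using zero by linarith
  qed
qed

text \<open>Solving the covering inequalities coordinate by coordinate gives \<open>a\<close> as a function \<open>G z\<close> of a
  guess \<open>z\<close> for the last entry. Each entry of \<open>G\<close> drops by 0 or 1 when \<open>z\<close> increases by 1: a fixed
  point of the last entry yields a big cube, and a jump of it across the diagonal a small one.\<close>

lemma model_cover:
  fixes x :: "nat \<Rightarrow> real"
  assumes p: "0 < p" "p < q" and n: "0 < n"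
  obtains (small) a where "\<And>k. k < n \<Longrightarrow> \<bar>x k - model_point p q n a k\<bar> \<le> p / 2"
    | (big) a where "\<And>k. k < n \<Longrightarrow> \<bar>x k - (model_point p q n a k + model_offset p q k)\<bar> \<le> q / 2"
proof -
  \<comment> \<open>\<open>y\<close> measures \<open>x\<close> from the lower corner of the big cube
    with \<open>a = 0\<close>. Lying in a big cube then means that certain remainders are between 0
    and \<open>q\<close>, which the floors in \<open>G\<close> achieve.\<close>
  define y where "y k = (if k = 0 then x 0 - p / 2 else x k + p / 2)" for k
  define G :: "int \<Rightarrow> nat \<Rightarrow> int" where
    "G z = rec_nat \<lfloor>(y 0 - p * z) / q\<rfloor> (\<lambda>k g. \<lfloor>(y (Suc k) + p * g) / q\<rfloor>)" for z
  have G0: "G z 0 = \<lfloor>(y 0 - p * z) / q\<rfloor>" and GS: "G z (Suc k) = \<lfloor>(y (Suc k) + p * G z k) / q\<rfloor>" for z k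
    by (auto simp: G_def)
  have fl: "0 \<le> t - q * \<lfloor>t / q\<rfloor> \<and> t - q * \<lfloor>t / q\<rfloor> < q" for t
    using p floor_divide_lower[of q t] floor_divide_upper[of q t] by (auto simp: algebra_simps)
  have diff: "G z k - G (z + 1) k \<in> {0, 1}" for z k
  proof (induction k)
    case 0
    have eq: "(y 0 - p * (z + 1)) / q = (y 0 - p * z) / q - p / q"
      by (simp add: algebra_simps diff_divide_distrib add_divide_distrib)
    have "0 < p / q" "p / q < 1" using p by auto
    then have "\<lfloor>(y 0 - p * z) / q\<rfloor> - 1 \<le> \<lfloor>(y 0 - p * (z + 1)) / q\<rfloor>" "\<lfloor>(y 0 - p * (z + 1)) / q\<rfloor> \<le> \<lfloor>(y 0 - p * z) / q\<rfloor>"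
      unfolding eq by linarith+
    then show ?case unfolding G0 by auto
  next
    case (Suc k)
    show ?case
    proof (cases "G z k = G (z + 1) k")
      case False
      then have "G z k = G (z + 1) k + 1" using Suc by auto
      then have eq: "(y (Suc k) + p * G z k) / q = (y (Suc k) + p * G (z + 1) k) / q + p / q"
        by (simp add: algebra_simps add_divide_distrib)
      have "0 < p / q" "p / q < 1" using p by auto
      then have "\<lfloor>(y (Suc k) + p * G (z + 1) k) / q\<rfloor> \<le> \<lfloor>(y (Suc k) + p * G z k) / q\<rfloor>"
        "\<lfloor>(y (Suc k) + p * G z k) / q\<rfloor> \<le> \<lfloor>(y (Suc k) + p * G (z + 1) k) / q\<rfloor> + 1"
        unfolding eq by linarith+
      then show ?thesis unfolding GS by auto
    qed (simp add: GS)
  qed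
  define g where "g z = G z (n - 1)" for z
  have antimono: "z \<le> w \<Longrightarrow> g w \<le> g z" for z w
  proof (induction w rule: int_ge_induct)
    case (step w)
    then show ?case using diff[of w "n - 1"] by (auto simp: g_def)
  qed simp
  \<comment> \<open>The last \<open>z\<close> with \<open>z \<le> g z\<close>. It exists because
    \<open>g\<close> is antimonotone, so it is above the diagonal at \<open>lo\<close> and below it
    at \<open>hi\<close>.\<close>
  obtain z where z: "z \<le> g z" "g (z + 1) \<le> z"
  proof -
    define lo where "lo = min 0 (g 0)"
    define hi where "hi = max 0 (g 0) + 1"
    have lo: "lo \<le> g lo" using antimono[of lo 0] by (auto simp: lo_def)
    have hi: "g hi < hi" using antimono[of 0 hi] by (auto simp: hi_def)
    define A where "A = {z \<in> {lo..hi}. z \<le> g z}"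
    have "finite A" by (rule finite_subset[of _ "{lo..hi}"]) (auto simp: A_def)
    moreover have "lo \<in> A" using lo by (auto simp: A_def lo_def hi_def)
    ultimately have M: "Max A \<in> A" "\<And>w. w \<in> A \<Longrightarrow> w \<le> Max A" by (auto intro: Max_in)
    then have "Max A < hi" using hi by (auto simp: A_def order.order_iff_strict)
    moreover have "Max A + 1 \<notin> A" using M(2)[of "Max A + 1"] by auto
    ultimately have "g (Max A + 1) \<le> Max A" using M(1) by (auto simp: A_def)
    with M(1) show ?thesis by (intro that[of "Max A"]) (auto simp: A_def)
  qed
  define a where "a = G z"
  have a0: "0 \<le> y 0 - p * z - q * a 0 \<and> y 0 - p * z - q * a 0 < q"
    using fl[of "y 0 - p * z"] by (simp add: a_def G0)
  have aS: "0 \<le> y (Suc k) + p * a k - q * a (Suc k) \<and> y (Suc k) + p * a k - q * a (Suc k) < q" for k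
    using fl[of "y (Suc k) + p * a k"] by (simp add: a_def GS)
  show ?thesis
  proof (cases "g z = z")
    case True
    then have "z = a (n - 1)" by (simp add: g_def a_def)
    show ?thesis
    proof (rule big[of a])
      fix k assume "k < n"
      show "\<bar>x k - (model_point p q n a k + model_offset p q k)\<bar> \<le> q / 2"
      proof (cases k)
        case 0
        then show ?thesis using a0 \<open>z = a (n - 1)\<close>
          by (auto simp: model_point_def model_offset_def twisted_shift_def y_def abs_le_iff field_simps)
      next
        case (Suc j)
        then show ?thesis using aS[of j]
          by (auto simp: model_point_def model_offset_def twisted_shift_def y_def abs_le_iff field_simps)
      qed
    qed
  next
    case False
    \<comment> \<open>The guesses \<open>z\<close> and \<open>z + 1\<close> now return
      \<open>z + 1\<close> and \<open>z\<close>. Two solutions that agree once agree from there on,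
      so \<open>b\<close> is \<open>a\<close> lowered by 1 in every entry. The lower bounds for
      \<open>a\<close> and the upper bounds for \<open>b\<close> confine \<open>x\<close> to width
      \<open>p\<close>.\<close>
    define b where "b = G (z + 1)"
    have last: "a (n - 1) = z + 1" "b (n - 1) = z"
      using False z diff[of z "n - 1"] by (auto simp: g_def a_def b_def)
    have stay: "j \<le> k \<Longrightarrow> a j = b j \<Longrightarrow> a k = b k" for j k
      by (induction k rule: dec_induct) (auto simp: a_def b_def GS)
    have b: "b k = a k - 1" if "k < n" for k
    proof -
      have "k \<le> n - 1" using that by simp
      then show ?thesis using stay[of k "n - 1"] last diff[of z k] by (auto simp: a_def b_def)
    qed
    have b0: "y 0 - p * (z + 1) - q * (a 0 - 1) < q"
      using fl[of "y 0 - p * (z + 1)"] b[of 0] n by (simp add: b_def G0)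
    have bS: "y (Suc k) + p * (a k - 1) - q * (a (Suc k) - 1) < q" if "Suc k < n" for k
      using fl[of "y (Suc k) + p * b k"] b[OF that] b[of k] that GS[of "z + 1" k] by (simp add: b_def)
    show ?thesis
    proof (rule small[of a])
      fix k assume "k < n"
      show "\<bar>x k - model_point p q n a k\<bar> \<le> p / 2"
      proof (cases k)
        case 0
        then show ?thesis using a0 b0 last unfolding abs_le_iff
          by (auto simp: model_point_def twisted_shift_def y_def algebra_simps)
      next
        case (Suc j)
        then show ?thesis using aS[of j] bS[of j] \<open>k < n\<close> unfolding abs_le_iff
          by (auto simp: model_point_def twisted_shift_def y_def algebra_simps)
      qed
    qed
  qed
qed

lemma model_point_eq_sum:
  assumes "m < n"
  shows "model_point p q n a m = (\<Sum>k<n. a k * model_point p q n (\<lambda>j. of_bool (j = k)) m)"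
proof (cases "m = 0")
  case True
  have "(\<Sum>k<n. a k * model_point p q n (\<lambda>j. of_bool (j = k)) m) =
      (\<Sum>k<n. if m = k then q * a k else 0) + (\<Sum>k<n. if n - 1 = k then p * a k else 0)"
    unfolding sum.distrib[symmetric]
    by (rule sum.cong) (auto simp: True model_point_def twisted_shift_def algebra_simps)
  then show ?thesis using assms True by (simp add: sum.delta' model_point_def twisted_shift_def)
next
  case False
  have "(\<Sum>k<n. a k * model_point p q n (\<lambda>j. of_bool (j = k)) m) =
      (\<Sum>k<n. if m = k then q * a k else 0) - (\<Sum>k<n. if m - 1 = k then p * a k else 0)"
    unfolding sum_subtractf[symmetric]
    by (rule sum.cong) (use False in \<open>auto simp: model_point_def twisted_shift_def algebra_simps\<close>)
  then show ?thesis using assms False by (simp add: sum.delta' model_point_def twisted_shift_def)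
qed

section \<open>Neighbours of a small cube\<close>

text \<open>The rank of an element is its number of predecessors. Transitivity makes the rank
  strictly monotone, so by totality it is injective, and its inverse is the enumeration.\<close>

lemma strict_total_order_enumeration:
  fixes less :: "'a::finite \<Rightarrow> 'a \<Rightarrow> bool"
  assumes irrefl: "\<And>i. \<not> less i i" and trans: "\<And>i j k. less i j \<Longrightarrow> less j k \<Longrightarrow> less i k"
    and total: "\<And>i j. i \<noteq> j \<Longrightarrow> less i j \<or> less j i"
  obtains r where "bij_betw r {..<CARD('a)} UNIV"
    "\<And>j k. j < k \<Longrightarrow> k < CARD('a) \<Longrightarrow> less (r j) (r k)"
proof -
  define s where "s i = card {j. less j i}" for i
  have mono: "s i < s j" if "less i j" for i j
    unfolding s_def
  proof (rule psubset_card_mono)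
    show "{k. less k i} \<subset> {k. less k j}" using that irrefl trans by blast
  qed simp
  have inj: "inj s"
  proof (rule injI)
    fix i j assume "s i = s j"
    then show "i = j" using mono[of i j] mono[of j i] total[of i j] by auto
  qed
  have "s i < CARD('a)" for i
    unfolding s_def by (rule psubset_card_mono) (use irrefl in auto)
  then have "range s = {..<CARD('a)}"
    by (intro card_subset_eq) (auto simp: card_image inj)
  then have bij: "bij_betw s UNIV {..<CARD('a)}" using inj by (simp add: bij_betw_def)
  show ?thesis
  proof (rule that[of "inv_into UNIV s"])
    show "bij_betw (inv_into UNIV s) {..<CARD('a)} UNIV" using bij by (rule bij_betw_inv_into)
    fix j k assume jk: "j < k" "k < CARD('a)"
    define u v where "u = inv_into UNIV s j" and "v = inv_into UNIV s k"
    have "s u = j" "s v = k" using jk bij by (auto simp: bij_betw_def u_def v_def intro!: f_inv_into_f)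
    then show "less u v" using mono[of v u] total[of u v] jk by auto
  qed
qed

text \<open>A sign vector names a vertex of the cube at the origin, and equally the reflection that
  carries this vertex to the positive orthant.\<close>

definition signs :: "('a \<Rightarrow> real) \<Rightarrow> bool" where
  "signs e \<longleftrightarrow> (\<forall>i. e i = 1 \<or> e i = -1)"

lemma signs_sq: "signs e \<Longrightarrow> e i * e i = 1"
  unfolding signs_def by (metis mult_1 mult_minus_left minus_minus mult.commute)

lemma signs_abs: "signs e \<Longrightarrow> \<bar>e i\<bar> = 1"
  unfolding signs_def by (metis abs_1 abs_minus_cancel)

lemma signs_flip: "signs e \<Longrightarrow> signs (e(j := - e j))"
  unfolding signs_def by (metis fun_upd_other fun_upd_same minus_minus)

lemma signs_abs_diff: "signs e \<Longrightarrow> \<bar>e i * x - e i * y\<bar> = \<bar>x - y\<bar>"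
  by (metis abs_mult mult_1 right_diff_distrib signs_abs)

text \<open>\<open>L\<close> and \<open>B\<close> are the sets of centres of the small and of the big cubes, translated so that one
  small cube is centred at the origin.\<close>

locale two_cube_lattice =
  fixes p q :: real and L B :: "(real ^ 'n) set"
  assumes p_pos: "0 < p" and p_less_q: "p < q"
    and zero_mem: "0 \<in> L"
    and diff_mem: "x \<in> L \<Longrightarrow> y \<in> L \<Longrightarrow> x - y \<in> L"
    and B_diff_B: "x \<in> B \<Longrightarrow> y \<in> B \<Longrightarrow> x - y \<in> L"
    and B_add_L: "x \<in> B \<Longrightarrow> y \<in> L \<Longrightarrow> x + y \<in> B"
    and L_sep: "x \<in> L \<Longrightarrow> x \<noteq> 0 \<Longrightarrow> \<exists>i. q \<le> \<bar>x $ i\<bar>"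
    and B_sep_0: "x \<in> B \<Longrightarrow> \<exists>i. (p + q) / 2 \<le> \<bar>x $ i\<bar>"
    and cover: "(\<exists>y\<in>L. \<forall>i. \<bar>x $ i - y $ i\<bar> \<le> p / 2) \<or> (\<exists>y\<in>B. \<forall>i. \<bar>x $ i - y $ i\<bar> \<le> q / 2)"
begin

section \<open>Lattice arithmetic and discreteness of the centres\<close>

lemma add_mem: "x \<in> L \<Longrightarrow> y \<in> L \<Longrightarrow> x + y \<in> L"
  using diff_mem[of x "0 - y"] diff_mem[OF zero_mem, of y] by simp

lemma minus_mem: "x \<in> L \<Longrightarrow> - x \<in> L"
  using diff_mem[OF zero_mem] by fastforce

lemma B_diff_L: "x \<in> B \<Longrightarrow> y \<in> L \<Longrightarrow> x - y \<in> B"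
  using B_add_L minus_mem by fastforce

lemma B_sep: "x \<in> B \<Longrightarrow> y \<in> B \<Longrightarrow> x \<noteq> y \<Longrightarrow> \<exists>i. q \<le> \<bar>x $ i - y $ i\<bar>"
  using L_sep[OF B_diff_B, of x y] by simp

text \<open>Distinct big centres are at distance at least \<open>q\<close>. Finiteness is what lets
  a sequence of test points near a vertex stay in one big cube.\<close>

lemma finite_B_bounded: "finite {x \<in> B. \<forall>i. \<bar>x $ i\<bar> \<le> r}"
proof -
  have "bounded {x \<in> B. \<forall>i. \<bar>x $ i\<bar> \<le> r}"
    by (rule bounded_subset[OF bounded_cbox[of "\<chi> i. - r" "\<chi> i. r"]])
      (auto simp: mem_box_cart abs_le_iff minus_le_iff)
  moreover have "uniform_discrete {x \<in> B. \<forall>i. \<bar>x $ i\<bar> \<le> r}"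
  proof (rule uniformI2)
    show "0 < q" using p_pos p_less_q by simp
    fix x y assume "x \<in> {x \<in> B. \<forall>i. \<bar>x $ i\<bar> \<le> r}" "y \<in> {x \<in> B. \<forall>i. \<bar>x $ i\<bar> \<le> r}" "x \<noteq> y"
    then obtain i where "q \<le> \<bar>(x - y) $ i\<bar>" using B_sep by fastforce
    also have "\<dots> \<le> dist x y" by (metis component_le_norm_cart dist_norm)
    finally show "q \<le> dist x y" .
  qed
  ultimately show ?thesis using uniform_discrete_finite_iff by blast
qed

lemma B_sep_signs:
  "signs e \<Longrightarrow> x \<in> B \<Longrightarrow> y \<in> B \<Longrightarrow> x \<noteq> y \<Longrightarrow> \<exists>i. q \<le> \<bar>e i * x $ i - e i * y $ i\<bar>"
  using B_sep[of x y] by (simp add: signs_abs_diff)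

text \<open>Small cubes cannot touch each other, so every orthant at a vertex of the small cube centred at
  the origin, other than the one of that cube, is filled near the vertex by a big cube.\<close>

lemma vertex_orthant:
  assumes e: "signs e" and W: "W \<noteq> {}"
  obtains x where "x \<in> B"
    "\<And>j. j \<notin> W \<Longrightarrow> - (q - p) / 2 \<le> e j * x $ j" "\<And>j. j \<notin> W \<Longrightarrow> e j * x $ j < (p + q) / 2"
    "\<And>j. j \<in> W \<Longrightarrow> - (q - p) / 2 < e j * x $ j" "\<And>j. j \<in> W \<Longrightarrow> e j * x $ j \<le> (p + q) / 2"
proof -
  \<comment> \<open>The test points \<open>z m\<close> approach the vertex \<open>e\<close>: outside
    the cube in the directions of \<open>W\<close>, inside in the others. The bound
    \<open>h m < q - p\<close> keeps them away from all other small cubes.\<close>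
  define h where "h m = (q - p) / (real m + 2)" for m :: nat
  define z :: "nat \<Rightarrow> real ^ 'n" where
    "z m = (\<chi> j. e j * (if j \<in> W then p / 2 + h m else p / 2 - h m))" for m
  have h: "0 < h m" "h m < q - p" for m
    using p_less_q by (auto simp: h_def divide_simps)
  have ez: "e j * z m $ j = (if j \<in> W then p / 2 + h m else p / 2 - h m)" for m j
    using signs_sq[OF e, of j] by (simp add: z_def flip: mult.assoc)
  have "\<exists>x\<in>B. \<forall>j. \<bar>z m $ j - x $ j\<bar> \<le> q / 2" for m
  proof (rule ccontr)
    assume "\<not> ?thesis"
    then obtain y where y: "y \<in> L" "\<And>j. \<bar>z m $ j - y $ j\<bar> \<le> p / 2" using cover by blast
    have "y = 0"
    proof (rule ccontr)
      assume "y \<noteq> 0"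
      then obtain j where "q \<le> \<bar>y $ j\<bar>" using L_sep y by blast
      moreover have "\<bar>z m $ j\<bar> = \<bar>e j * z m $ j\<bar>" using signs_abs[OF e] by (simp add: abs_mult)
      then have "\<bar>z m $ j\<bar> \<le> p / 2 + h m" using h[of m] p_pos unfolding ez by (auto split: if_splits)
      ultimately show False using y(2)[of j] h[of m] by linarith
    qed
    obtain j where j: "j \<in> W" using W by blast
    have "\<bar>e j * z m $ j\<bar> = \<bar>z m $ j\<bar>" using signs_abs[OF e] by (simp add: abs_mult)
    then show False using y(2)[of j] \<open>y = 0\<close> j h[of m] p_pos unfolding ez by simp
  qed
  then obtain f where f: "\<And>m. f m \<in> B" "\<And>m j. \<bar>z m $ j - f m $ j\<bar> \<le> q / 2" by metis
  have "range f \<subseteq> {x \<in> B. \<forall>i. \<bar>x $ i\<bar> \<le> 2 * q}"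
  proof clarsimp
    fix m
    have "\<bar>f m $ j\<bar> \<le> 2 * q" for j
    proof -
      have "\<bar>z m $ j\<bar> = \<bar>e j * z m $ j\<bar>" using signs_abs[OF e] by (simp add: abs_mult)
      then have "\<bar>z m $ j\<bar> \<le> p / 2 + h m" using h[of m] p_pos unfolding ez by (auto split: if_splits)
      then show ?thesis using f(2)[of m j] h[of m] p_pos by linarith
    qed
    then show "f m \<in> B \<and> (\<forall>i. \<bar>f m $ i\<bar> \<le> 2 * q)" using f by blast
  qed
  then have "finite (range f)" using finite_B_bounded finite_subset by blast
  \<comment> \<open>One big cube contains infinitely many test points. The weak bounds on its centre
    follow in the limit, the strict ones from a single test point.\<close>
  then obtain m0 where inf: "infinite {m. f m = f m0}"
    using pigeonhole_infinite[of UNIV f] by auto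
  define x where "x = f m0"
  have close: "\<exists>m. h m < t \<and> (\<forall>j. \<bar>e j * z m $ j - e j * x $ j\<bar> \<le> q / 2)" if "0 < t" for t
  proof -
    obtain N :: nat where N: "(q - p) / t < real N" using reals_Archimedean2 by blast
    obtain m where m: "N \<le> m" "f m = x" using inf unfolding infinite_nat_iff_unbounded_le x_def by blast
    have "(q - p) / t < real m + 2" using N m by simp
    then have "h m < t" using that by (simp add: h_def divide_simps mult.commute)
    then show ?thesis using f(2)[of m] m by (auto simp: signs_abs_diff[OF e])
  qed
  have lower: "- (q - p) / 2 \<le> e j * x $ j" if "j \<notin> W" for j
  proof (rule field_le_epsilon)
    fix t :: real assume "0 < t"
    then obtain m where "h m < t" "\<bar>e j * z m $ j - e j * x $ j\<bar> \<le> q / 2" using close by blast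
    then show "- (q - p) / 2 \<le> e j * x $ j + t" using that unfolding ez by (simp add: abs_le_iff field_simps)
  qed
  have upper: "e j * x $ j \<le> (p + q) / 2" if "j \<in> W" for j
  proof (rule field_le_epsilon)
    fix t :: real assume "0 < t"
    then obtain m where "h m < t" "\<bar>e j * z m $ j - e j * x $ j\<bar> \<le> q / 2" using close by blast
    then show "e j * x $ j \<le> (p + q) / 2 + t" using that unfolding ez by (simp add: abs_le_iff field_simps)
  qed
  obtain m where m: "\<And>j. \<bar>e j * z m $ j - e j * x $ j\<bar> \<le> q / 2" using close[of 1] by auto
  show ?thesis
  proof (rule that[of x])
    show "x \<in> B" using f x_def by simp
    show "e j * x $ j < (p + q) / 2" if "j \<notin> W" for j
      using m[of j] that h(1)[of m] unfolding ez by (simp add: abs_le_iff field_simps)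
    show "- (q - p) / 2 < e j * x $ j" if "j \<in> W" for j
      using m[of j] that h(1)[of m] unfolding ez by (simp add: abs_le_iff field_simps)
  qed (use lower upper in auto)
qed

text \<open>The big cube at centre \<open>x\<close> lies against facet \<open>i\<close> at the
  vertex \<open>e\<close> and covers this facet near the vertex. The value
  \<open>- (q - p) / 2\<close> in direction \<open>j\<close> means that it ends exactly at facet
  \<open>j\<close>, that is, it is flush there.\<close>

definition neighbour :: "('n \<Rightarrow> real) \<Rightarrow> 'n \<Rightarrow> real ^ 'n \<Rightarrow> bool" where
  "neighbour e i x \<longleftrightarrow> x \<in> B \<and> e i * x $ i = (p + q) / 2 \<and>
     (\<forall>j. j \<noteq> i \<longrightarrow> - (q - p) / 2 \<le> e j * x $ j \<and> e j * x $ j < (p + q) / 2)"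

text \<open>The cube filling the orthant beyond facet \<open>i\<close> must be separated from the
  small one in some coordinate, and its bounds allow this only in coordinate \<open>i\<close>, with
  equality.\<close>

lemma neighbour_ex:
  assumes e: "signs e"
  obtains x where "neighbour e i x"
proof -
  obtain x where x: "x \<in> B"
    "\<And>j. j \<notin> {i} \<Longrightarrow> - (q - p) / 2 \<le> e j * x $ j" "\<And>j. j \<notin> {i} \<Longrightarrow> e j * x $ j < (p + q) / 2"
    "\<And>j. j \<in> {i} \<Longrightarrow> - (q - p) / 2 < e j * x $ j" "\<And>j. j \<in> {i} \<Longrightarrow> e j * x $ j \<le> (p + q) / 2"
    using vertex_orthant[OF e, of "{i}"] by blast
  obtain k where k: "(p + q) / 2 \<le> \<bar>x $ k\<bar>" using B_sep_0 x(1) by blast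
  have "\<bar>x $ k\<bar> = \<bar>e k * x $ k\<bar>" using signs_abs[OF e] by (simp add: abs_mult)
  moreover have "- (p + q) / 2 < - (q - p) / 2" using p_pos by simp
  ultimately have "k = i \<and> e i * x $ i = (p + q) / 2"
    using x(2-5)[of k] k by (cases "k = i") auto
  then have "neighbour e i x" using x by (auto simp: neighbour_def)
  then show ?thesis by (rule that)
qed

text \<open>In every direction other than \<open>i\<close> both centres lie in a half-open interval
  of length \<open>q\<close>, too short to separate two big cubes.\<close>

lemma neighbour_unique:
  assumes e: "signs e" and x: "neighbour e i x" and y: "neighbour e i y"
  shows "x = y"
proof (rule ccontr)
  assume "x \<noteq> y"
  then obtain k where k: "q \<le> \<bar>e k * x $ k - e k * y $ k\<bar>"
    using B_sep_signs[OF e] x y unfolding neighbour_def by blast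
  have "k \<noteq> i" using x y k p_pos p_less_q unfolding neighbour_def by auto
  then have "- (q - p) / 2 \<le> e k * x $ k \<and> e k * x $ k < (p + q) / 2"
    "- (q - p) / 2 \<le> e k * y $ k \<and> e k * y $ k < (p + q) / 2" using x y unfolding neighbour_def by auto
  then show False using k by (auto simp: field_simps abs_if split: if_splits)
qed

text \<open>Two big cubes past adjacent facets can be separated only in direction \<open>i\<close>
  or \<open>j\<close>, and there the required gap \<open>q\<close> is the extreme value
  allowed.\<close>

lemma neighbour_flush:
  assumes e: "signs e" and ij: "i \<noteq> j" and x: "neighbour e i x" and y: "neighbour e j y"
  shows "e j * x $ j = - (q - p) / 2 \<or> e i * y $ i = - (q - p) / 2"
proof -
  have "e i * x $ i = (p + q) / 2" "e i * y $ i < (p + q) / 2" using x y ij by (auto simp: neighbour_def)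
  then have "x \<noteq> y" by auto
  then obtain k where k: "q \<le> \<bar>e k * x $ k - e k * y $ k\<bar>"
    using B_sep_signs[OF e] x y unfolding neighbour_def by blast
  have xk: "if k = i then e k * x $ k = (p + q) / 2 else - (q - p) / 2 \<le> e k * x $ k \<and> e k * x $ k < (p + q) / 2"
    using x by (auto simp: neighbour_def)
  have yk: "if k = j then e k * y $ k = (p + q) / 2 else - (q - p) / 2 \<le> e k * y $ k \<and> e k * y $ k < (p + q) / 2"
    using y by (auto simp: neighbour_def)
  consider "k = i" | "k = j" | "k \<noteq> i" "k \<noteq> j" by blast
  then show ?thesis
  proof cases
    case 1
    then have "e i * y $ i = - (q - p) / 2" using k xk yk ij by (auto simp: field_simps abs_if split: if_splits)
    then show ?thesis ..
  next
    case 2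
    then have "e j * x $ j = - (q - p) / 2" using k xk yk ij by (auto simp: field_simps abs_if split: if_splits)
    then show ?thesis ..
  next
    case 3
    then show ?thesis using k xk yk by (auto simp: field_simps abs_if split: if_splits)
  qed
qed

text \<open>Since \<open>q > p\<close>, a cube flush at one end of an edge reaches past the other
  end, so it is also the neighbour at the adjacent vertex.\<close>

lemma neighbour_flip:
  assumes "i \<noteq> j" "neighbour e i x" "e j * x $ j = - (q - p) / 2"
  shows "neighbour (e(j := - e j)) i x"
  using assms p_less_q p_pos by (auto simp: neighbour_def)

text \<open>A cube flush at one vertex is not flush at the next, so there the other facet's
  neighbour must be. This runs through the vertices \<open>e\<close>, \<open>?ej\<close>,
  \<open>?eij\<close>, \<open>?ei\<close> of a two-dimensional face and returns to \<open>e\<close>,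
  where uniqueness identifies \<open>y2\<close> with \<open>y\<close>.\<close>

lemma neighbour_pinwheel:
  assumes e: "signs e" and ij: "i \<noteq> j" and x: "neighbour e i x" and y: "neighbour e j y"
    and flush: "e j * x $ j = - (q - p) / 2" and x': "neighbour (e(i := - e i, j := - e j)) i x'"
  shows "e j * x' $ j = (q - p) / 2" "e i * y $ i = (q - p) / 2"
proof -
  let ?ej = "e(j := - e j)" and ?ei = "e(i := - e i)" and ?eij = "e(i := - e i, j := - e j)"
  have s: "signs ?ej" "signs ?ei" "signs ?eij"
    using signs_flip[OF e] signs_flip[OF signs_flip[OF e, of i], of j] ij by auto
  have eij: "?ej(i := - ?ej i) = ?eij" "?eij(j := - ?eij j) = ?ei" "?ei(i := - ?ei i) = e"
    using ij by auto
  have nz: "(q - p) / 2 \<noteq> - (q - p) / 2" using p_less_q by simp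
  have 1: "neighbour ?ej i x" using neighbour_flip ij x flush by simp
  obtain y1 where y1: "neighbour ?ej j y1" using neighbour_ex s by blast
  have "?ej j * x $ j = (q - p) / 2" using flush by simp
  then have "e i * y1 $ i = - (q - p) / 2"
    using neighbour_flush[OF s(1) ij 1 y1] ij nz by (metis fun_upd_other)
  then have 2: "neighbour ?eij j y1" "e i * y1 $ i = - (q - p) / 2"
    using neighbour_flip[of j i ?ej y1] ij y1 eij by auto
  have "?eij i * y1 $ i = (q - p) / 2" using 2(2) ij by simp
  then have "?eij j * x' $ j = - (q - p) / 2"
    using neighbour_flush[OF s(3) ij x' 2(1)] nz by metis
  then show 3: "e j * x' $ j = (q - p) / 2" by simp
  have "?eij j * x' $ j = - (q - p) / 2" using 3 by simp
  then have 4: "neighbour ?ei i x'"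
    using neighbour_flip[OF ij x'] eij(2) by metis
  obtain y2 where y2: "neighbour ?ei j y2" using neighbour_ex s by blast
  have "?ei j * x' $ j = (q - p) / 2" using 3 ij by simp
  then have "?ei i * y2 $ i = - (q - p) / 2"
    using neighbour_flush[OF s(2) ij 4 y2] nz by metis
  then have 5: "e i * y2 $ i = (q - p) / 2" by simp
  have "neighbour e j y2"
    using neighbour_flip[OF ij[symmetric] y2] \<open>?ei i * y2 $ i = - (q - p) / 2\<close> eij(3) by metis
  then show "e i * y $ i = (q - p) / 2" using neighbour_unique[OF e y] 5 by simp
qed

text \<open>Either \<open>x\<close> is flush itself, or the neighbour at facet \<open>j\<close> is,
  and then the pinwheel started from that one gives the opposite value.\<close>

lemma neighbour_abs:
  assumes e: "signs e" and ij: "i \<noteq> j" and x: "neighbour e i x"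
  shows "\<bar>x $ j\<bar> = (q - p) / 2"
proof -
  obtain y where y: "neighbour e j y" using neighbour_ex e by blast
  obtain y' where y': "neighbour (e(j := - e j, i := - e i)) j y'"
    using neighbour_ex signs_flip[OF signs_flip[OF e, of j], of i] ij by (metis fun_upd_other)
  have "\<bar>e j * x $ j\<bar> = (q - p) / 2"
    using neighbour_flush[OF e ij x y]
  proof
    assume "e i * y $ i = - (q - p) / 2"
    then show ?thesis using neighbour_pinwheel(2)[OF e ij[symmetric] y x _ y'] p_less_q by simp
  qed (use p_less_q in simp)
  then show ?thesis using signs_abs[OF e] by (simp add: abs_mult)
qed

text \<open>The coordinates found in \<open>neighbour_abs\<close> satisfy the bounds for either
  sign, so the neighbour depends on the facet only: one big cube covers the whole facet.\<close>

lemma neighbour_cong: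
  assumes "signs e" "neighbour e i x" "signs e'" "e' i = e i"
  shows "neighbour e' i x"
proof -
  have "- (q - p) / 2 \<le> e' j * x $ j \<and> e' j * x $ j < (p + q) / 2" if "j \<noteq> i" for j
  proof -
    have "\<bar>e' j * x $ j\<bar> = (q - p) / 2"
      using neighbour_abs[OF assms(1) _ assms(2)] that signs_abs[OF assms(3)] by (auto simp: abs_mult)
    then show ?thesis using p_pos p_less_q by (auto simp: abs_if field_simps split: if_splits)
  qed
  then show ?thesis using assms by (simp add: neighbour_def)
qed

lemma neighbour_minus:
  assumes e: "signs e" and x: "neighbour e i x"
  shows "- x \<in> B"
proof -
  have me: "signs (\<lambda>k. - e k)" using e unfolding signs_def by (metis minus_minus)
  obtain x' where x': "neighbour (\<lambda>k. - e k) i x'" using neighbour_ex me by blast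
  have "x' = - x"
  proof (rule vec_eq_iff[THEN iffD2], intro allI)
    fix j
    show "x' $ j = (- x) $ j"
    proof (cases "j = i")
      case True
      have "e i * (x' $ i + x $ i) = 0" using x x' by (simp add: neighbour_def algebra_simps)
      then show ?thesis using True signs_sq[OF e, of i] by auto
    next
      case False
      \<comment> \<open>The pinwheel needs a vertex at which \<open>x\<close> is flush in direction
        \<open>j\<close>. This is \<open>e\<close> or \<open>e\<close> with the sign at
        \<open>j\<close> flipped, and both neighbours remain the same under the change of
        vertex.\<close>
      have *: "f j * x' $ j = (q - p) / 2" if f: "signs f" "f i = e i" "f j * x $ j = - (q - p) / 2" for f
      proof -
        obtain y where y: "neighbour f j y" using neighbour_ex f by blast
        have "signs (f(i := - f i, j := - f j))"
          using signs_flip[OF signs_flip[OF f(1), of i], of j] False by auto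
        then have "neighbour (f(i := - f i, j := - f j)) i x'"
          using neighbour_cong[OF me x'] f False by auto
        then show ?thesis
          using neighbour_pinwheel(1)[OF f(1) _ neighbour_cong[OF e x f(1,2)] y f(3)] False by blast
      qed
      have "\<bar>e j * x $ j\<bar> = (q - p) / 2"
        using neighbour_abs[OF e _ x, of j] False signs_abs[OF e] by (simp add: abs_mult)
      then have "e j * x' $ j = - (e j * x $ j)"
        using *[OF e] *[OF signs_flip[OF e, of j]] False by (auto simp: abs_if split: if_splits)
      then have "e j * (x' $ j + x $ j) = 0" by (simp add: algebra_simps)
      then show ?thesis using signs_sq[OF e, of j] by auto
    qed
  qed
  then show ?thesis using x' by (simp add: neighbour_def)
qed

text \<open>The sign of \<open>c i $ j\<close> orients the pair \<open>i\<close>, \<open>j\<close>;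
  antisymmetry makes this a tournament.\<close>

lemma neighbours:
  obtains c where "\<And>i. c i \<in> B" "\<And>i. - c i \<in> B" "\<And>i. c i $ i = (p + q) / 2"
    "\<And>i j. i \<noteq> j \<Longrightarrow> \<bar>c i $ j\<bar> = (q - p) / 2" "\<And>i j. i \<noteq> j \<Longrightarrow> c j $ i = - c i $ j"
proof -
  have s: "signs (\<lambda>_. 1)" by (simp add: signs_def)
  have "\<exists>x. neighbour (\<lambda>_. 1) i x" for i using neighbour_ex[OF s] by blast
  then obtain c where c: "\<And>i. neighbour (\<lambda>_. 1) i (c i)" by metis
  have abs: "\<bar>c i $ j\<bar> = (q - p) / 2" if "i \<noteq> j" for i j using neighbour_abs[OF s that c] .
  have anti: "c j $ i = (q - p) / 2" if "i \<noteq> j" "c i $ j = - (q - p) / 2" for i j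
  proof -
    have "signs ((\<lambda>_. 1)(i := - 1, j := - 1))" by (auto simp: signs_def)
    then obtain x' where "neighbour ((\<lambda>_. 1)(i := - 1, j := - 1)) i x'" using neighbour_ex by blast
    then show ?thesis using neighbour_pinwheel(2)[OF s that(1) c c, of x'] that by simp
  qed
  have anti': "c j $ i = - (q - p) / 2" if "i \<noteq> j" "c i $ j = (q - p) / 2" for i j
  proof (rule ccontr)
    assume "\<not> ?thesis"
    then have "\<not> c j $ i = - (q - p) / 2" "\<not> c i $ j = - (q - p) / 2" using that p_less_q by auto
    then show False using neighbour_flush[OF s that(1) c c] by simp
  qed
  show ?thesis
  proof (rule that[of c])
    show "c i \<in> B" "- c i \<in> B" "c i $ i = (p + q) / 2" for i
      using c[of i] neighbour_minus[OF s c] by (auto simp: neighbour_def)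
    show "c j $ i = - c i $ j" if "i \<noteq> j" for i j
      using abs[OF that] anti[OF that] anti'[OF that] by (auto simp: abs_if split: if_splits)
  qed (use abs in auto)
qed

lemma axis_notin_L: "axis i q \<notin> L"
proof
  assume a: "axis i q \<in> L"
  obtain c where c: "\<And>i. c i \<in> B" "\<And>i. - c i \<in> B" "\<And>i. c i $ i = (p + q) / 2"
    "\<And>i j. i \<noteq> j \<Longrightarrow> \<bar>c i $ j\<bar> = (q - p) / 2" "\<And>i j. i \<noteq> j \<Longrightarrow> c j $ i = - c i $ j"
    using neighbours by blast
  \<comment> \<open>All coordinates of \<open>c i - axis i q\<close> have absolute value
    \<open>(q - p) / 2\<close>, so the shifted cube overlaps the small one.\<close>
  obtain k where "(p + q) / 2 \<le> \<bar>(c i - axis i q) $ k\<bar>"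
    using B_sep_0 B_diff_L[OF c(1) a] by blast
  then show False using c(3)[of i] c(4)[of i k] p_pos p_less_q
    by (cases "k = i") (auto simp: axis_def abs_if field_simps split: if_splits)
qed

text \<open>The orthant pointing towards the three facets of the cycle contains none of their big
  neighbours, hence is filled by another big cube \<open>x\<close>. Subtracting the three neighbours from \<open>x\<close>
  leaves a lattice vector too short to be nonzero.\<close>

lemma no_dominating_cycle:
  assumes c: "\<And>i. c i \<in> B" "\<And>i. - c i \<in> B" "\<And>i. c i $ i = (p + q) / 2"
    "\<And>i j. i \<noteq> j \<Longrightarrow> \<bar>c i $ j\<bar> = (q - p) / 2" "\<And>i j. i \<noteq> j \<Longrightarrow> c j $ i = - c i $ j"
    and e: "signs e" and dist: "distinct [z, u, v, w]"
    and cycle: "e u * e v * c u $ v = - (q - p) / 2" "e v * e w * c v $ w = - (q - p) / 2"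
      "e w * e u * c w $ u = - (q - p) / 2"
    and dom: "e u * e z * c u $ z = - (q - p) / 2" "e v * e z * c v $ z = - (q - p) / 2"
      "e w * e z * c w $ z = - (q - p) / 2"
  shows False
proof -
  define h s where "h = (q - p) / 2" and "s = (p + q) / 2"
  have hs: "0 < h" "h < s" "h + s = q" using p_pos p_less_q by (auto simp: h_def s_def field_simps)
  \<comment> \<open>Off the four given coordinates the sign is chosen to make the signed sum of the
    three neighbours nonpositive; this is used only in the final bound.\<close>
  define f where "f k = (if k \<in> {z, u, v, w} then e k
    else if e u * c u $ k + e v * c v $ k + e w * c w $ k < 0 then 1 else - 1)" for k
  have f: "signs f" using e by (auto simp: signs_def f_def)
  have fe: "f z = e z" "f u = e u" "f v = e v" "f w = e w" by (auto simp: f_def)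
  define C where "C i k = f k * (f i * c i $ k)" for i k
  let ?W = "{u, v, w}"
  obtain x where x: "x \<in> B"
    "\<And>j. j \<notin> ?W \<Longrightarrow> - (q - p) / 2 \<le> f j * x $ j" "\<And>j. j \<notin> ?W \<Longrightarrow> f j * x $ j < (p + q) / 2"
    "\<And>j. j \<in> ?W \<Longrightarrow> - (q - p) / 2 < f j * x $ j" "\<And>j. j \<in> ?W \<Longrightarrow> f j * x $ j \<le> (p + q) / 2"
    using vertex_orthant[OF f, of ?W] by blast
  define X where "X k = f k * x $ k" for k
  have X_out: "- h \<le> X k \<and> X k < s" if "k \<notin> ?W" for k
    using x(2,3)[OF that] by (simp add: X_def h_def s_def minus_divide_left)
  have X_in: "- h < X k \<and> X k \<le> s" if "k \<in> ?W" for k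
    using x(4,5)[OF that] by (simp add: X_def h_def s_def minus_divide_left)
  have X: "- h \<le> X k \<and> X k \<le> s" for k using X_out[of k] X_in[of k] by force
  have CB: "f i *\<^sub>R c i \<in> B" for i using f c(1,2)[of i] unfolding signs_def by (metis scaleR_minus1_left scaleR_one)
  have Cii: "C i i = s" for i
    using signs_sq[OF f, of i] by (simp add: C_def c s_def flip: mult.assoc)
  have Cabs: "\<bar>C i k\<bar> = h" if "i \<noteq> k" for i k
    using signs_abs[OF f] c(4)[OF that] by (simp add: C_def abs_mult h_def)
  have Canti: "C k i = - C i k" if "i \<noteq> k" for i k
    using c(5)[OF that] by (simp add: C_def)
  have Ccyc: "C u v = - h" "C v w = - h" "C w u = - h" "C u z = - h" "C v z = - h" "C w z = - h"
    using cycle dom fe by (simp_all add: C_def h_def minus_divide_left mult.assoc mult.left_commute)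
  then have Ccyc': "C v u = h" "C w v = h" "C u w = h" using Canti dist by auto
  have sep: "\<exists>m. q \<le> \<bar>X m - C i m\<bar>" if "\<exists>k. X k \<noteq> C i k" for i
  proof -
    have "x \<noteq> f i *\<^sub>R c i" using that by (auto simp: X_def C_def)
    then show ?thesis using B_sep_signs[OF f x(1) CB[of i]] by (auto simp: X_def C_def)
  qed
  \<comment> \<open>\<open>x\<close> is not the neighbour at \<open>a\<close>, since they differ in
    coordinate \<open>b\<close>. Only coordinate \<open>b\<close> can provide the gap
    \<open>q\<close>, which pushes \<open>X b\<close> to its maximum.\<close>
  have X_W: "X b = s" if abd: "a \<in> ?W" "b \<in> ?W" "a \<noteq> b" "C a b = - h"
    "\<And>d. d \<in> ?W \<Longrightarrow> d \<noteq> a \<Longrightarrow> d \<noteq> b \<Longrightarrow> C a d = h" for a b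
  proof -
    obtain m where m: "q \<le> \<bar>X m - C a m\<bar>" using sep[of a] X_in[OF abd(2)] abd(4) by force
    consider "m = a" | "m = b" | "m \<in> ?W" "m \<noteq> a" "m \<noteq> b" | "m \<notin> ?W" by blast
    then show ?thesis
    proof cases
      case 1 then show ?thesis using m X_in[OF abd(1)] Cii[of a] hs by auto
    next
      case 2 then show ?thesis using m X_in[OF abd(2)] abd(4) hs by auto
    next
      case 3 then show ?thesis using m X_in[OF 3(1)] abd(5) hs by auto
    next
      case 4
      then have "\<bar>C a m\<bar> = h" using Cabs[of a m] abd(1) by metis
      then show ?thesis using m X_out[OF 4] hs by linarith
    qed
  qed
  have "X v = s" by (rule X_W[of u v]) (use Ccyc Ccyc' dist in auto)
  moreover have "X w = s" by (rule X_W[of v w]) (use Ccyc Ccyc' dist in auto)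
  moreover have "X u = s" by (rule X_W[of w u]) (use Ccyc Ccyc' dist in auto)
  ultimately have XW: "X k = s" if "k \<in> ?W" for k using that by auto
  \<comment> \<open>Here \<open>x\<close> is compared with the neighbour at facet \<open>k\<close>.
    Only coordinate \<open>k\<close> can separate the two, which pushes \<open>X k\<close> down to
    \<open>- h\<close>.\<close>
  have X_dom: "X k = - h" if k: "k \<notin> ?W" "C u k = - h" "C v k = - h" "C w k = - h" for k
  proof -
    have "X k \<noteq> C k k" using X_out[OF k(1)] Cii[of k] by linarith
    then obtain m where m: "q \<le> \<bar>X m - C k m\<bar>" using sep[of k] by blast
    consider "m = k" | "m \<in> ?W" | "m \<notin> ?W" "m \<noteq> k" by blast
    then show ?thesis
    proof cases
      case 1 then show ?thesis using m X_out[OF k(1)] Cii[of k] hs by auto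
    next
      case 2
      then have "C k m = h" using k Canti[of m k] by auto
      then show ?thesis using m XW[OF 2] hs by auto
    next
      case 3 then show ?thesis using m X_out[OF 3(1)] Cabs[OF 3(2)[symmetric]] hs by linarith
    qed
  qed
  define y where "y = x - (f u *\<^sub>R c u + f v *\<^sub>R c v + f w *\<^sub>R c w)"
  have "- (f w *\<^sub>R c w) \<in> B"
    using f c(1,2)[of w] unfolding signs_def by (metis scaleR_minus1_left scaleR_one minus_minus)
  then have "f v *\<^sub>R c v - - (f w *\<^sub>R c w) \<in> L" by (rule B_diff_B[OF CB])
  with B_diff_B[OF x(1) CB[of u]] have "x - f u *\<^sub>R c u - (f v *\<^sub>R c v - - (f w *\<^sub>R c w)) \<in> L"
    by (rule diff_mem)
  also have "x - f u *\<^sub>R c u - (f v *\<^sub>R c v - - (f w *\<^sub>R c w)) = y" by (simp add: y_def)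
  finally have yL: "y \<in> L" .
  define S where "S k = C u k + C v k + C w k" for k
  have fy: "f k * y $ k = X k - S k" for k
    by (simp add: y_def X_def S_def C_def algebra_simps)
  have bound: "\<bar>X k - S k\<bar> < q" for k
  proof (cases "k \<in> ?W")
    case True
    then have "S k = s" using Cii Ccyc Ccyc' by (auto simp: S_def)
    then show ?thesis using XW[OF True] hs by auto
  next
    case False
    show ?thesis
    proof (cases "C u k = - h \<and> C v k = - h \<and> C w k = - h")
      case True
      then show ?thesis using X_dom[OF False] hs p_pos by (simp add: S_def h_def)
    next
      case nd: False
      then have "k \<noteq> z" using Ccyc by auto
      define t where "t = e u * c u $ k + e v * c v $ k + e w * c w $ k"
      have "S k = f k * t" using fe by (simp add: S_def C_def t_def algebra_simps)
      moreover have "f k = (if t < 0 then 1 else - 1)" using False \<open>k \<noteq> z\<close> by (simp add: f_def t_def)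
      ultimately have "S k \<le> 0" by auto
      moreover have "\<bar>C u k\<bar> = h" "\<bar>C v k\<bar> = h" "\<bar>C w k\<bar> = h" using False Cabs by auto
      \<comment> \<open>A sum of three terms \<open>h\<close> or \<open>- h\<close> that is
        nonpositive but not \<open>- 3 * h\<close> equals \<open>- h\<close>.\<close>
      ultimately have "S k = - h" using nd hs by (auto simp: S_def abs_if split: if_splits)
      then show ?thesis using X_out[OF False] hs by auto
    qed
  qed
  have "z \<notin> ?W" using dist by auto
  \<comment> \<open>At the dominating coordinate \<open>X z = - h\<close> while
    \<open>S z = - 3 * h\<close>, so the short vector is not zero.\<close>
  then have "f z * y $ z \<noteq> 0" unfolding fy using X_dom[of z] Ccyc hs by (auto simp: S_def)
  then have "y \<noteq> 0" by auto
  then obtain k where "q \<le> \<bar>y $ k\<bar>" using L_sep yL by blast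
  moreover have "\<bar>f k * y $ k\<bar> = \<bar>y $ k\<bar>" using signs_abs[OF f] by (simp add: abs_mult)
  ultimately show False using bound[of k] fy[of k] by simp
qed

section \<open>Identification of the centres with the model lattice\<close>

lemma scaleR_int_mem: "x \<in> L \<Longrightarrow> real_of_int a *\<^sub>R x \<in> L"
proof (induction a rule: int_induct[where k = 0])
  case base then show ?case using zero_mem by simp
next
  case (step1 a) then show ?case using add_mem[of "a *\<^sub>R x" x] by (simp add: scaleR_left_distrib)
next
  case (step2 a) then show ?case using diff_mem[of "a *\<^sub>R x" x] by (simp add: scaleR_left_diff_distrib)
qed

lemma sum_mem: "finite K \<Longrightarrow> (\<And>k. k \<in> K \<Longrightarrow> g k \<in> L) \<Longrightarrow> sum g K \<in> L"
  by (induction K rule: finite_induct) (auto intro: zero_mem add_mem)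

text \<open>Reflections make one coordinate \<open>z\<close> dominate all others. A failure of
  transitivity would be a three-cycle avoiding \<open>z\<close>, hence dominated by it, which is
  impossible. So the tournament is a linear order, and \<open>r\<close> lists it.\<close>

lemma ordered_neighbours:
  "\<exists>e r C. signs e \<and> bij_betw r {..<CARD('n)} UNIV \<and> (\<forall>k. C k \<in> B \<and> - C k \<in> B) \<and>
    (\<forall>k<CARD('n). \<forall>m<CARD('n). e (r m) * C k $ r m =
      (if k = m then (p + q) / 2 else if k < m then (q - p) / 2 else - (q - p) / 2))"
proof -
  obtain c where c: "\<And>i. c i \<in> B" "\<And>i. - c i \<in> B" "\<And>i. c i $ i = (p + q) / 2"
    "\<And>i j. i \<noteq> j \<Longrightarrow> \<bar>c i $ j\<bar> = (q - p) / 2" "\<And>i j. i \<noteq> j \<Longrightarrow> c j $ i = - c i $ j"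
    using neighbours by blast
  define h where "h = (q - p) / 2"
  have h: "0 < h" using p_less_q by (simp add: h_def)
  define z :: 'n where "z = undefined"
  define e where "e j = (if j = z then 1 else sgn (c z $ j))" for j
  have e: "signs e"
    unfolding signs_def
  proof
    fix i
    have "c z $ i \<noteq> 0" if "i \<noteq> z" using c(4)[of z i] h that by (auto simp: h_def)
    then show "e i = 1 \<or> e i = - 1" by (auto simp: e_def sgn_if)
  qed
  define K where "K i j = e i * e j * c i $ j" for i j
  have K_abs: "\<bar>K i j\<bar> = h" if "i \<noteq> j" for i j
    using signs_abs[OF e] c(4)[OF that] by (simp add: K_def abs_mult h_def)
  have K_anti: "K j i = - K i j" if "i \<noteq> j" for i j
    using c(5)[OF that] by (simp add: K_def)
  have Kz: "K z j = h" if "j \<noteq> z" for j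
  proof -
    have "K z j = \<bar>c z $ j\<bar>" using that by (simp add: K_def e_def abs_sgn mult.commute)
    then show ?thesis using c(4)[of z j] that by (simp add: h_def)
  qed
  define less where "less i j \<longleftrightarrow> i \<noteq> j \<and> K i j = h" for i j
  have not_less: "K i j = - h" if "i \<noteq> j" "\<not> less i j" for i j
    using K_abs[OF that(1)] that unfolding less_def by linarith
  have trans: "less i k" if ij: "less i j" and jk: "less j k" for i j k
  proof (rule ccontr)
    assume nik: "\<not> less i k"
    have ne: "i \<noteq> j" "j \<noteq> k" using ij jk by (auto simp: less_def)
    have ji: "K j i = - h" and kj: "K k j = - h"
      using ij jk K_anti by (auto simp: less_def)
    have "i \<noteq> k" using ij kj h by (auto simp: less_def)
    then have ik: "K i k = - h" using nik not_less by blast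
    have nz: "i \<noteq> z" "j \<noteq> z" "k \<noteq> z" using ik ji kj Kz h ne \<open>i \<noteq> k\<close> by fastforce+
    then have "K i z = - h" "K j z = - h" "K k z = - h" using Kz K_anti by metis+
    then have K: "K i z = - (q - p) / 2" "K j z = - (q - p) / 2" "K k z = - (q - p) / 2"
      "K i k = - (q - p) / 2" "K k j = - (q - p) / 2" "K j i = - (q - p) / 2"
      using ik ji kj by (simp_all add: h_def minus_divide_left)
    have distinct: "distinct [z, i, k, j]" using nz ne \<open>i \<noteq> k\<close> by auto
    \<comment> \<open>The cycle is traversed as \<open>i\<close>, \<open>k\<close>,
      \<open>j\<close>, against \<open>less\<close>, because \<open>no_dominating_cycle\<close>
      expects negative entries along it.\<close>
    show False
      by (rule no_dominating_cycle[of c e z i k j]) (fact c e distinct K[unfolded K_def])+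
  qed
  obtain r where r: "bij_betw r {..<CARD('n)} UNIV"
    "\<And>j k. j < k \<Longrightarrow> k < CARD('n) \<Longrightarrow> less (r j) (r k)"
  proof (rule strict_total_order_enumeration[of less])
    show "less i j \<or> less j i" if "i \<noteq> j" for i j
    proof (cases "less i j")
      case False
      then have "K j i = h" using not_less[OF that] K_anti[OF that] by simp
      then show ?thesis using that by (simp add: less_def)
    qed simp
    show "\<not> less i i" for i by (simp add: less_def)
    show "less i k" if "less i j" "less j k" for i j k using trans[OF that] .
  qed blast
  define C where "C k = e (r k) *\<^sub>R c (r k)" for k
  have "C k \<in> B" "- C k \<in> B" for k
    using e c(1,2)[of "r k"] unfolding signs_def C_def by (metis scaleR_minus1_left scaleR_one minus_minus)+
  moreover have "e (r m) * C k $ r m =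
      (if k = m then (p + q) / 2 else if k < m then (q - p) / 2 else - (q - p) / 2)"
    if km: "k < CARD('n)" "m < CARD('n)" for k m
  proof -
    have "e (r m) * C k $ r m = K (r k) (r m)" by (simp add: K_def C_def)
    moreover have "K (r k) (r k) = (p + q) / 2" using signs_sq[OF e] c(3) by (simp add: K_def)
    moreover have "K (r k) (r m) = h" if "k < m" using r(2)[of k m] that km by (simp add: less_def)
    moreover have "K (r k) (r m) = - h" if "m < k"
      using r(2)[of m k] K_anti[of "r m" "r k"] that km by (simp add: less_def)
    ultimately show ?thesis by (auto simp: h_def minus_divide_left)
  qed
  ultimately show ?thesis using e r(1) by (intro exI[of _ e] exI[of _ r] exI[of _ C]) blast
qed

text \<open>The model centres are found inside \<open>L\<close> and \<open>B\<close>. As their cubes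
  already cover the space, no further centre fits.\<close>

lemma model_coordinates:
  obtains e r where "signs e" "bij_betw r {..<CARD('n)} UNIV"
    "L = {x. \<exists>a. \<forall>k<CARD('n). e (r k) * x $ r k = model_point p q CARD('n) a k}"
    "B = {x. \<exists>a. \<forall>k<CARD('n). e (r k) * x $ r k = model_point p q CARD('n) a k + model_offset p q k}"
proof -
  let ?n = "CARD('n)"
  obtain e r C where e: "signs e" and r: "bij_betw r {..<?n} UNIV"
    and *: "\<forall>k. C k \<in> B \<and> - C k \<in> B" "\<forall>k<?n. \<forall>m<?n. e (r m) * C k $ r m =
      (if k = m then (p + q) / 2 else if k < m then (q - p) / 2 else - (q - p) / 2)"
    using ordered_neighbours by blast
  then have C: "C k \<in> B" "- C k \<in> B" for k by auto
  have C_coord: "e (r m) * C k $ r m =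
      (if k = m then (p + q) / 2 else if k < m then (q - p) / 2 else - (q - p) / 2)"
    if "k < ?n" "m < ?n" for k m using *(2) that by blast
  define L' where "L' = {x. \<exists>a. \<forall>k<?n. e (r k) * x $ r k = model_point p q ?n a k}"
  define B' where "B' = {x. \<exists>a. \<forall>k<?n. e (r k) * x $ r k = model_point p q ?n a k + model_offset p q k}"
  have n: "0 < ?n" by simp
  have ex_r: "\<exists>k<?n. i = r k" for i
  proof -
    have "i \<in> r ` {..<?n}" using r by (simp add: bij_betw_def)
    then show ?thesis by blast
  qed
  have vec_eqI: "x = y" if "\<And>k. k < ?n \<Longrightarrow> e (r k) * x $ r k = e (r k) * y $ r k" for x y :: "real ^ 'n"
  proof (rule vec_eq_iff[THEN iffD2], intro allI)
    fix i obtain k where "k < ?n" "i = r k" using ex_r by blast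
    then show "x $ i = y $ i" using that[of k] signs_abs[OF e, of i] by force
  qed
  \<comment> \<open>Consecutive neighbours differ only in two coordinates, by \<open>q\<close> and
    \<open>- p\<close>; the last vector uses \<open>- C 0\<close> and produces the sign change at
    the wrap.\<close>
  define g where "g k = (if Suc k < ?n then C k - C (Suc k) else C k - - C 0)" for k
  have gL: "g k \<in> L" for k
    using B_diff_B[OF C(1) C(1)] B_diff_B[OF C(1) C(2)] unfolding g_def by presburger
  have g_coord: "e (r m) * g k $ r m = model_point p q ?n (\<lambda>j. of_bool (j = k)) m"
    if km: "k < ?n" "m < ?n" for k m
  proof (cases "Suc k < ?n")
    case True
    have "e (r m) * g k $ r m = e (r m) * C k $ r m - e (r m) * C (Suc k) $ r m"
      using True by (simp add: g_def algebra_simps)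
    also have "\<dots> = (if m = k then q else if m = Suc k then - p else 0)"
      unfolding C_coord[OF km] C_coord[OF True km(2)] by (auto simp: field_simps)
    also have "\<dots> = model_point p q ?n (\<lambda>j. of_bool (j = k)) m"
      using True km by (auto simp: model_point_def twisted_shift_def)
    finally show ?thesis .
  next
    case False
    then have "k = ?n - 1" using km by simp
    have "e (r m) * g k $ r m = e (r m) * C k $ r m + e (r m) * C 0 $ r m"
      using False by (simp add: g_def algebra_simps)
    also have "\<dots> = (if m = k then q else 0) + (if m = 0 then p else 0)"
      unfolding C_coord[OF km] C_coord[OF n km(2)] using km \<open>k = ?n - 1\<close> by (auto simp: field_simps)
    also have "\<dots> = model_point p q ?n (\<lambda>j. of_bool (j = k)) m"
      using km \<open>k = ?n - 1\<close> by (auto simp: model_point_def twisted_shift_def)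
    finally show ?thesis .
  qed
  have sub_L: "L' \<subseteq> L"
  proof
    fix x assume "x \<in> L'"
    then obtain a where a: "\<And>k. k < ?n \<Longrightarrow> e (r k) * x $ r k = model_point p q ?n a k" by (auto simp: L'_def)
    have "x = (\<Sum>k<?n. a k *\<^sub>R g k)"
    proof (rule vec_eqI)
      fix m assume m: "m < ?n"
      have "e (r m) * (\<Sum>k<?n. a k *\<^sub>R g k) $ r m = (\<Sum>k<?n. a k * (e (r m) * g k $ r m))"
        unfolding sum_component sum_distrib_left by (rule sum.cong) simp_all
      also have "\<dots> = model_point p q ?n a m"
        unfolding model_point_eq_sum[OF m, of p q a] by (rule sum.cong) (simp_all add: g_coord m)
      finally show "e (r m) * x $ r m = e (r m) * (\<Sum>k<?n. a k *\<^sub>R g k) $ r m" using a m by simp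
    qed
    then show "x \<in> L" using gL by (auto intro!: sum_mem scaleR_int_mem)
  qed
  have sub_B: "B' \<subseteq> B"
  proof
    fix x assume "x \<in> B'"
    then obtain a where a: "\<And>k. k < ?n \<Longrightarrow> e (r k) * x $ r k = model_point p q ?n a k + model_offset p q k"
      by (auto simp: B'_def)
    have "e (r k) * (x - C 0) $ r k = model_point p q ?n a k" if "k < ?n" for k
    proof -
      have "e (r k) * C 0 $ r k = model_offset p q k"
        using C_coord[OF n that] that by (simp add: model_offset_def)
      then show ?thesis using a[OF that] by (simp add: right_diff_distrib)
    qed
    then have "x - C 0 \<in> L" using sub_L unfolding L'_def by blast
    then show "x \<in> B" using B_add_L[OF C(1)[of 0], of "x - C 0"] by simp
  qed
  have model: "(\<exists>y\<in>L'. \<forall>i. \<bar>x $ i - y $ i\<bar> \<le> p / 2) \<or> (\<exists>y\<in>B'. \<forall>i. \<bar>x $ i - y $ i\<bar> \<le> q / 2)"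
    for x :: "real ^ 'n"
  proof -
    have lift: "\<exists>y. (\<forall>k<?n. e (r k) * y $ r k = Y k) \<and> (\<forall>i. \<bar>x $ i - y $ i\<bar> \<le> t)"
      if Y: "\<And>k. k < ?n \<Longrightarrow> \<bar>e (r k) * x $ r k - Y k\<bar> \<le> t" for Y t
    proof -
      define y where "y = (\<chi> i. e i * Y (inv_into {..<?n} r i))"
      have y: "e (r k) * y $ r k = Y k" if "k < ?n" for k
        using signs_sq[OF e, of "r k"] bij_betw_inv_into_left[OF r] that by (simp add: y_def flip: mult.assoc)
      have "\<bar>x $ i - y $ i\<bar> \<le> t" for i
      proof -
        obtain k where "k < ?n" "i = r k" using ex_r by blast
        then show ?thesis using Y[of k] y[of k] signs_abs_diff[OF e, of i "x $ i" "y $ i"] by simp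
      qed
      then show ?thesis using y by blast
    qed
    show ?thesis
    proof (rule model_cover[OF p_pos p_less_q n, of "\<lambda>k. e (r k) * x $ r k"])
      fix a assume "\<And>k. k < ?n \<Longrightarrow> \<bar>e (r k) * x $ r k - model_point p q ?n a k\<bar> \<le> p / 2"
      from lift[OF this] obtain y where y: "\<forall>k<?n. e (r k) * y $ r k = model_point p q ?n a k"
        "\<forall>i. \<bar>x $ i - y $ i\<bar> \<le> p / 2" by blast
      then have "y \<in> L'" unfolding L'_def by blast
      then show ?thesis using y by blast
    next
      fix a assume "\<And>k. k < ?n \<Longrightarrow>
        \<bar>e (r k) * x $ r k - (model_point p q ?n a k + model_offset p q k)\<bar> \<le> q / 2"
      from lift[OF this] obtain y where
        y: "\<forall>k<?n. e (r k) * y $ r k = model_point p q ?n a k + model_offset p q k"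
        "\<forall>i. \<bar>x $ i - y $ i\<bar> \<le> q / 2" by blast
      then have "y \<in> B'" unfolding B'_def by blast
      then show ?thesis using y by blast
    qed
  qed
  \<comment> \<open>The next three facts say that the centre of a tile lies in no other tile. The
    model tile covering a given centre is therefore the tile with that centre.\<close>
  have close_L: "x = y" if xy: "x \<in> L" "y \<in> L" "\<And>i. \<bar>x $ i - y $ i\<bar> \<le> p / 2" for x y
  proof (rule ccontr)
    assume "x \<noteq> y"
    then obtain i where "q \<le> \<bar>(x - y) $ i\<bar>" using L_sep[OF diff_mem[OF xy(1,2)]] by auto
    then show False using xy(3)[of i] p_pos p_less_q by simp
  qed
  have close_B: "x = y" if xy: "x \<in> B" "y \<in> B" "\<And>i. \<bar>x $ i - y $ i\<bar> \<le> q / 2" for x y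
  proof (rule ccontr)
    assume "x \<noteq> y"
    then obtain i where "q \<le> \<bar>x $ i - y $ i\<bar>" using B_sep xy by blast
    then show False using xy(3)[of i] p_pos p_less_q by simp
  qed
  have far: "\<exists>i. q / 2 < \<bar>x $ i - y $ i\<bar>" if xy: "x \<in> B" "y \<in> L" for x y
  proof -
    obtain i where "(p + q) / 2 \<le> \<bar>(x - y) $ i\<bar>" using B_sep_0 B_diff_L xy by blast
    then have "q / 2 < \<bar>x $ i - y $ i\<bar>" using p_pos by (simp add: field_simps)
    then show ?thesis by blast
  qed
  have "L \<subseteq> L'"
  proof
    fix x assume x: "x \<in> L"
    from model[of x] show "x \<in> L'"
    proof
      assume "\<exists>y\<in>L'. \<forall>i. \<bar>x $ i - y $ i\<bar> \<le> p / 2"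
      then show ?thesis using close_L x sub_L by blast
    next
      assume "\<exists>y\<in>B'. \<forall>i. \<bar>x $ i - y $ i\<bar> \<le> q / 2"
      then obtain y where "y \<in> B" "\<forall>i. \<bar>x $ i - y $ i\<bar> \<le> q / 2" using sub_B by blast
      then show ?thesis using far[of y x] x by (metis abs_minus_commute not_le)
    qed
  qed
  moreover have "B \<subseteq> B'"
  proof
    fix x assume x: "x \<in> B"
    from model[of x] show "x \<in> B'"
    proof
      assume "\<exists>y\<in>L'. \<forall>i. \<bar>x $ i - y $ i\<bar> \<le> p / 2"
      then obtain y where y: "y \<in> L" "\<forall>i. \<bar>x $ i - y $ i\<bar> \<le> p / 2" using sub_L by blast
      obtain i where "q / 2 < \<bar>x $ i - y $ i\<bar>" using far x y by blast
      then have False using spec[OF y(2), of i] p_less_q by linarith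
      then show ?thesis ..
    next
      assume "\<exists>y\<in>B'. \<forall>i. \<bar>x $ i - y $ i\<bar> \<le> q / 2"
      then show ?thesis using close_B x sub_B by blast
    qed
  qed
  ultimately have "L = L'" "B = B'" using sub_L sub_B by auto
  then show ?thesis using that[OF e r] unfolding L'_def B'_def by blast
qed

end

section \<open>Tilings by cubes\<close>

text \<open>Cubes are described by centres, so that overlap and covering become coordinatewise
  inequalities between centres.\<close>

definition cube :: "real \<Rightarrow> real ^ 'n \<Rightarrow> (real ^ 'n) set" where
  "cube s c = {x. \<forall>i. \<bar>x $ i - c $ i\<bar> \<le> s / 2}"

lemma One_eq_1: "(One :: real ^ 'n) = 1"
proof (rule vec_eq_iff[THEN iffD2], intro allI)
  fix i :: 'n
  have "axis i (1 :: real) \<in> Basis" by (simp add: axis_in_Basis_iff)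
  then have "(One :: real ^ 'n) \<bullet> axis i 1 = 1" using inner_sum_left_Basis[of _ "\<lambda>_. 1"] by fastforce
  then show "(One :: real ^ 'n) $ i = 1 $ i" by (simp only: cart_eq_inner_axis[symmetric] one_index)
qed

lemma cube_eq_cbox: "cube s c = cbox (c - (s / 2) *\<^sub>R 1) (c + (s / 2) *\<^sub>R 1)"
proof -
  have "\<bar>x - y\<bar> \<le> h \<longleftrightarrow> y - h \<le> x \<and> x \<le> y + h" for x y h :: real by linarith
  then show ?thesis unfolding cube_def by (simp only:) (simp add: set_eq_iff mem_box_cart)
qed

lemma is_hcube_iff: "is_hcube s C \<longleftrightarrow> 0 < s \<and> (\<exists>c. C = cube s c)"
proof -
  have "cbox a (a + s *\<^sub>R 1) = cube s (a + (s / 2) *\<^sub>R 1)" for a :: "real ^ 'a"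
    unfolding cube_eq_cbox by (rule arg_cong2[of _ _ _ _ cbox]) (simp_all add: vec_eq_iff)
  moreover have "cube s c = cbox (c - (s / 2) *\<^sub>R 1) (c - (s / 2) *\<^sub>R 1 + s *\<^sub>R 1)" for c :: "real ^ 'a"
    unfolding cube_eq_cbox by (rule arg_cong2[of _ _ _ _ cbox]) (simp_all add: vec_eq_iff)
  ultimately show ?thesis unfolding is_hcube_def One_eq_1 by metis
qed

lemma center_mem_cube: "0 < s \<Longrightarrow> c \<in> cube s c"
  by (simp add: cube_def)

lemma cube_eq_iff:
  assumes "0 < s" "0 < t"
  shows "cube s c = cube t d \<longleftrightarrow> s = t \<and> c = d"
proof
  assume eq: "cube s c = cube t d"
  have "cube s c \<noteq> {}" using center_mem_cube assms by blast
  then have *: "c - (s / 2) *\<^sub>R 1 = d - (t / 2) *\<^sub>R 1" "c + (s / 2) *\<^sub>R 1 = d + (t / 2) *\<^sub>R 1"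
    using eq unfolding cube_eq_cbox eq_cbox by auto
  have eqs: "c $ i - s / 2 = d $ i - t / 2" "c $ i + s / 2 = d $ i + t / 2" for i
    using arg_cong[OF *(1), of "\<lambda>x. x $ i"] arg_cong[OF *(2), of "\<lambda>x. x $ i"] by simp_all
  have "s = t" using eqs[of undefined] by linarith
  moreover from this have "c $ i = d $ i" for i using eqs[of i] by simp
  ultimately show "s = t \<and> c = d" by (simp add: vec_eq_iff)
qed simp

text \<open>The intersection is a box, negligible exactly when its open box is empty, that is, when
  some side has nonpositive length.\<close>

lemma negligible_cube_Int_iff:
  assumes "0 < s" "0 < t"
  shows "negligible (cube s c \<inter> cube t d) \<longleftrightarrow> (\<exists>i. (s + t) / 2 \<le> \<bar>c $ i - d $ i\<bar>)"
proof -
  let ?a = "\<chi> i. max (c $ i - s / 2) (d $ i - t / 2)" and ?b = "\<chi> i. min (c $ i + s / 2) (d $ i + t / 2)"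
  have "cube s c \<inter> cube t d = cbox ?a ?b"
    by (auto simp: cube_eq_cbox mem_box_cart set_eq_iff)
  then have "negligible (cube s c \<inter> cube t d) \<longleftrightarrow> box ?a ?b = {}"
    by (simp add: negligible_interval)
  also have "\<dots> \<longleftrightarrow> (\<exists>i. ?b $ i \<le> ?a $ i)" by (simp add: interval_eq_empty_cart)
  also have "\<dots> \<longleftrightarrow> (\<exists>i. (s + t) / 2 \<le> \<bar>c $ i - d $ i\<bar>)"
    by (rule ex_cong1) (use assms in \<open>auto simp: min_def max_def abs_if field_simps\<close>)
  finally show ?thesis .
qed

lemma translation_cube: "(\<lambda>x. x + l) ` cube s c = cube s (c + l)"
proof
  show "cube s (c + l) \<subseteq> (\<lambda>x. x + l) ` cube s c"
  proof
    fix y assume "y \<in> cube s (c + l)"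
    then have "y - l \<in> cube s c" by (simp add: cube_def algebra_simps)
    then show "y \<in> (\<lambda>x. x + l) ` cube s c" by (intro image_eqI[of _ _ "y - l"]) auto
  qed
qed (auto simp: cube_def)

lemma closed_cube: "closed (cube s c)"
  unfolding cube_eq_cbox by (rule closed_cbox)

lemma convex_cube: "convex (cube s c)"
  unfolding cube_eq_cbox by (rule convex_box)

text \<open>Passing to a proper face lowers the affine dimension. A facet is only one dimension
  below \<open>S\<close>, so no proper face fits strictly between.\<close>

lemma facet_of_eq_face_of:
  assumes "convex S" "G facet_of S" "H face_of S" "H \<noteq> S" "G \<subseteq> H"
  shows "G = H"
proof (rule ccontr)
  assume "G \<noteq> H"
  have H: "convex H" "aff_dim H < aff_dim S"
    using face_of_imp_convex assms face_of_aff_dim_lt by blast+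
  have "G face_of H" using assms by (meson face_of_subset face_of_imp_subset facet_of_imp_face_of)
  then have "aff_dim G < aff_dim H" using H \<open>G \<noteq> H\<close> face_of_aff_dim_lt by blast
  then show False using assms(2) H by (simp add: facet_of_def)
qed

text \<open>A common facet lies in the touching hyperplane and so is the whole facet of the first
  cube. Its width \<open>s\<close> in every other direction fixes the centre of the second.\<close>

lemma common_facet_cubes:
  fixes c d :: "real ^ 'n"
  assumes s: "0 < s" and i: "s \<le> d $ i - c $ i" and G: "G facet_of cube s c" "G facet_of cube s d"
  shows "d - c = axis i s"
proof -
  have sub: "G \<subseteq> cube s c" "G \<subseteq> cube s d" "G \<noteq> {}"
    using G by (auto simp: facet_of_def dest: face_of_imp_subset)
  have le: "x $ i \<le> c $ i + s / 2" if "x \<in> cube s c" for x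
  proof -
    have "\<bar>x $ i - c $ i\<bar> \<le> s / 2" using that by (simp add: cube_def)
    then show ?thesis by linarith
  qed
  have ge: "d $ i - s / 2 \<le> x $ i" if "x \<in> cube s d" for x
  proof -
    have "\<bar>x $ i - d $ i\<bar> \<le> s / 2" using that by (simp add: cube_def)
    then show ?thesis by linarith
  qed
  obtain x where x: "x \<in> cube s c" "x \<in> cube s d" using sub by blast
  have di: "d $ i = c $ i + s" using le[OF x(1)] ge[OF x(2)] i by simp
  let ?H = "cube s c \<inter> {x. axis i 1 \<bullet> x = c $ i + s / 2}"
  have "G = ?H"
  proof (rule facet_of_eq_face_of[OF convex_cube G(1)])
    show "?H face_of cube s c"
      by (rule face_of_Int_supporting_hyperplane_le[OF convex_cube]) (simp add: inner_axis' le)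
    have "c \<notin> ?H" using s by (simp add: inner_axis')
    then show "?H \<noteq> cube s c" using center_mem_cube[OF s, of c] by blast
    show "G \<subseteq> ?H"
    proof
      fix y assume "y \<in> G"
      then have y: "y \<in> cube s c" "y \<in> cube s d" using sub by auto
      then show "y \<in> ?H" using le[OF y(1)] ge[OF y(2)] di by (simp add: inner_axis')
    qed
  qed
  then have sub_d: "?H \<subseteq> cube s d" using sub by simp
  have "c $ j = d $ j" if "j \<noteq> i" for j
  proof -
    \<comment> \<open>Two points at opposite ends of the facet in direction
      \<open>j\<close>.\<close>
    have "c + axis i (s / 2) + axis j (s / 2) \<in> ?H" "c + axis i (s / 2) - axis j (s / 2) \<in> ?H"
      unfolding Int_iff mem_Collect_eq inner_axis' using s that by (auto simp: cube_def axis_def)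
    then have "c + axis i (s / 2) + axis j (s / 2) \<in> cube s d" "c + axis i (s / 2) - axis j (s / 2) \<in> cube s d"
      using sub_d by blast+
    then have "\<bar>(c + axis i (s / 2) + axis j (s / 2)) $ j - d $ j\<bar> \<le> s / 2"
      "\<bar>(c + axis i (s / 2) - axis j (s / 2)) $ j - d $ j\<bar> \<le> s / 2" unfolding cube_def by blast+
    then have "\<bar>c $ j + s / 2 - d $ j\<bar> \<le> s / 2" "\<bar>c $ j - s / 2 - d $ j\<bar> \<le> s / 2"
      using that by (simp_all add: axis_def)
    then show ?thesis by linarith
  qed
  then show ?thesis using di by (auto simp: vec_eq_iff axis_def)
qed

section \<open>From a lattice tiling to the centres of its tiles\<close>

lemma lattice_of_closed:
  shows "0 \<in> lattice_of M" "x \<in> lattice_of M \<Longrightarrow> y \<in> lattice_of M \<Longrightarrow> x - y \<in> lattice_of M"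
proof -
  have "\<exists>z. 0 = M *v z \<and> (\<forall>i. z $ i \<in> \<int>)" by (rule exI[of _ 0]) simp
  then show "0 \<in> lattice_of M" by (auto simp: lattice_of_def)
  assume "x \<in> lattice_of M" "y \<in> lattice_of M"
  then obtain z w where "x = M *v z" "\<forall>i. z $ i \<in> \<int>" "y = M *v w" "\<forall>i. w $ i \<in> \<int>"
    by (auto simp: lattice_of_def)
  then have "x - y = M *v (z - w) \<and> (\<forall>i. (z - w) $ i \<in> \<int>)" by (simp add: matrix_vector_mult_diff_distrib)
  then show "x - y \<in> lattice_of M" unfolding lattice_of_def by blast
qed

text \<open>Moving the small cube \<open>S0\<close> to the origin turns the big centres into the
  coset \<open>b - t + L\<close>.\<close>

lemma lattice_cube_tiling_centers:
  fixes F :: "(real ^ 'n) set set"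
  assumes F: "lattice_cube_tiling p q F" and pq: "0 < p" "p < q"
  obtains t L B where "two_cube_lattice p q L B"
    "F = {cube p (t + x) | x. x \<in> L} \<union> {cube q (t + x) | x. x \<in> B}"
proof -
  obtain M S0 T0 where M: "is_hcube p S0" "is_hcube q T0"
    "F = {(\<lambda>x. x + l) ` S0 | l. l \<in> lattice_of M} \<union> {(\<lambda>x. x + l) ` T0 | l. l \<in> lattice_of M}"
    and tiling: "is_tiling F"
    using F by (auto simp: lattice_cube_tiling_def)
  obtain t b where tb: "S0 = cube p t" "T0 = cube q b" using M by (auto simp: is_hcube_iff)
  define L where "L = lattice_of M"
  define B where "B = {b - t + l | l. l \<in> L}"
  have "{cube q (b + l) | l. l \<in> L} = {cube q (t + x) | x. x \<in> B}"
  proof safe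
    fix l assume "l \<in> L"
    then show "\<exists>x. cube q (b + l) = cube q (t + x) \<and> x \<in> B"
      by (intro exI[of _ "b - t + l"]) (auto simp: B_def)
  next
    fix x assume "x \<in> B"
    then obtain l where "l \<in> L" "x = b - t + l" by (auto simp: B_def)
    then show "\<exists>l. cube q (t + x) = cube q (b + l) \<and> l \<in> L" by (intro exI[of _ l]) simp
  qed
  then have F: "F = {cube p (t + x) | x. x \<in> L} \<union> {cube q (t + x) | x. x \<in> B}"
    unfolding M(3) tb translation_cube L_def[symmetric] by simp
  have L: "0 \<in> L" "x \<in> L \<Longrightarrow> y \<in> L \<Longrightarrow> x - y \<in> L" for x y
    using lattice_of_closed by (auto simp: L_def)
  have add: "x + y \<in> L" if "x \<in> L" "y \<in> L" for x y
    using L(2)[OF that(1) L(2)[OF L(1) that(2)]] by simp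
  have disj: "negligible (S \<inter> T)" if "S \<in> F" "T \<in> F" "S \<noteq> T" for S T
    using tiling that by (simp add: is_tiling_def)
  have q: "0 < q" using pq by simp
  have "two_cube_lattice p q L B"
  proof
    show "0 < p" "p < q" "0 \<in> L" by (fact pq L)+
    show "x - y \<in> L" if "x \<in> L" "y \<in> L" for x y using L(2)[OF that] .
    show "x - y \<in> L" if "x \<in> B" "y \<in> B" for x y
      using that L(2) by (auto simp: B_def)
    show "x + y \<in> B" if "x \<in> B" "y \<in> L" for x y
      using that add unfolding B_def by (auto simp: add.assoc)
    show "\<exists>i. q \<le> \<bar>x $ i\<bar>" if x: "x \<in> L" "x \<noteq> 0" for x
    proof -
      \<comment> \<open>The vector \<open>x\<close> is tested on two big tiles, which gives the gap
        \<open>q\<close>; two small tiles would give only \<open>p\<close>.\<close>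
      have "b - t \<in> B" "b - t + x \<in> B" using L(1) x unfolding B_def by force+
      then have "cube q (t + (b - t)) \<in> F" "cube q (t + (b - t + x)) \<in> F" unfolding F by blast+
      moreover have "cube q (t + (b - t)) \<noteq> cube q (t + (b - t + x))"
        using q x by (simp add: cube_eq_iff)
      ultimately have "negligible (cube q (t + (b - t)) \<inter> cube q (t + (b - t + x)))" by (rule disj)
      then show ?thesis using negligible_cube_Int_iff[OF q q, of "t + (b - t)" "t + (b - t + x)"] by simp
    qed
    show "\<exists>i. (p + q) / 2 \<le> \<bar>x $ i\<bar>" if x: "x \<in> B" for x
    proof -
      have "cube p (t + 0) \<in> F" "cube q (t + x) \<in> F" unfolding F using x L(1) by blast+
      moreover have "cube p (t + 0) \<noteq> cube q (t + x)" using pq q by (simp add: cube_eq_iff)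
      ultimately show ?thesis using disj negligible_cube_Int_iff[OF pq(1) q, of "t + 0" "t + x"] by simp
    qed
    show "(\<exists>y\<in>L. \<forall>i. \<bar>x $ i - y $ i\<bar> \<le> p / 2) \<or> (\<exists>y\<in>B. \<forall>i. \<bar>x $ i - y $ i\<bar> \<le> q / 2)" for x
    proof -
      have "t + x \<in> \<Union>F" using tiling by (simp add: is_tiling_def)
      then consider y where "y \<in> L" "t + x \<in> cube p (t + y)" | y where "y \<in> B" "t + x \<in> cube q (t + y)"
        unfolding F by blast
      then show ?thesis
      proof cases
        case 1
        then have "\<forall>i. \<bar>x $ i - y $ i\<bar> \<le> p / 2" by (simp add: cube_def)
        then show ?thesis using 1 by blast
      next
        case 2
        then have "\<forall>i. \<bar>x $ i - y $ i\<bar> \<le> q / 2" by (simp add: cube_def)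
        then show ?thesis using 2 by blast
      qed
    qed
  qed
  from this F show ?thesis by (rule that)
qed

text \<open>A shared facet would put \<open>axis i s\<close> into \<open>L\<close>. For
  \<open>s = q\<close> this contradicts \<open>axis_notin_L\<close>, and for \<open>s = p\<close>
  the vector is shorter than \<open>L_sep\<close> allows.\<close>

lemma lattice_cube_tiling_unilateral:
  fixes F :: "(real ^ 'n) set set"
  assumes F: "lattice_cube_tiling p q F" and pq: "0 < p" "p < q"
  shows "unilateral F"
  unfolding unilateral_def
proof (intro ballI impI notI)
  obtain t L B where tc: "two_cube_lattice p q L B"
    and F_eq: "F = {cube p (t + x) | x. x \<in> L} \<union> {cube q (t + x) | x. x \<in> B}"
    using lattice_cube_tiling_centers[OF F pq] .
  interpret two_cube_lattice p q L B by (fact tc)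
  have q: "0 < q" using pq by simp
  fix S T assume ST: "S \<in> F" "T \<in> F" and same: "S \<noteq> T \<and> (\<exists>s. is_hcube s S \<and> is_hcube s T)"
    and "\<exists>G. G facet_of S \<and> G facet_of T"
  then obtain s G where s: "is_hcube s S" "is_hcube s T" and G: "G facet_of S" "G facet_of T" by blast
  obtain c d where cd: "0 < s" "S = cube s c" "T = cube s d" using s by (auto simp: is_hcube_iff)
  have mem: "s = p \<and> c - t \<in> L \<or> s = q \<and> c - t \<in> B" if "cube s c \<in> F" for c
    using that pq q cd unfolding F_eq by (auto simp: cube_eq_iff)
  have cd_L: "c - d \<in> L" "d - c \<in> L" "s = p \<or> s = q"
    using mem[of c] mem[of d] ST cd pq diff_mem[of "c - t" "d - t"] diff_mem[of "d - t" "c - t"]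
      B_diff_B[of "c - t" "d - t"] B_diff_B[of "d - t" "c - t"] by auto
  have "c \<noteq> d" using same cd by auto
  then obtain i where "q \<le> \<bar>(c - d) $ i\<bar>" using L_sep[OF cd_L(1)] by auto
  then have "s \<le> d $ i - c $ i \<or> s \<le> c $ i - d $ i" using cd_L(3) pq by auto
  then have "axis i s \<in> L"
    using common_facet_cubes[OF cd(1)] G cd cd_L by metis
  then have "s = p" "axis i p \<in> L" using cd_L(3) axis_notin_L by auto
  then obtain k where "q \<le> \<bar>axis i p $ k\<bar>" using L_sep[of "axis i p"] pq by (auto simp: axis_eq_0_iff)
  then show False using pq by (auto simp: axis_def split: if_splits)
qed

text \<open>The parameters are the freedom left by the classification: a translation
  \<open>t\<close>, reflections \<open>e\<close> and a numbering \<open>r\<close> of the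
  coordinates.\<close>

definition model_cubes :: "real \<Rightarrow> real \<Rightarrow> real ^ 'n \<Rightarrow> ('n \<Rightarrow> real) \<Rightarrow> (nat \<Rightarrow> 'n) \<Rightarrow> (real ^ 'n) set set" where
  "model_cubes p q t e r =
    {cube p x | x. \<exists>a. \<forall>k<CARD('n). e (r k) * (x - t) $ r k = model_point p q CARD('n) a k} \<union>
    {cube q x | x. \<exists>a. \<forall>k<CARD('n). e (r k) * (x - t) $ r k = model_point p q CARD('n) a k + model_offset p q k}"

lemma lattice_cube_tiling_eq_model:
  fixes F :: "(real ^ 'n) set set"
  assumes F: "lattice_cube_tiling p q F" and pq: "0 < p" "p < q"
  obtains t e r where "signs e" "bij_betw r {..<CARD('n)} UNIV" "F = model_cubes p q t e r"
proof -
  obtain t L B where tc: "two_cube_lattice p q L B"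
    and F_eq: "F = {cube p (t + x) | x. x \<in> L} \<union> {cube q (t + x) | x. x \<in> B}"
    using lattice_cube_tiling_centers[OF F pq] .
  interpret two_cube_lattice p q L B by (fact tc)
  obtain e r where er: "signs e" "bij_betw r {..<CARD('n)} UNIV"
    and L: "L = {x. \<exists>a. \<forall>k<CARD('n). e (r k) * x $ r k = model_point p q CARD('n) a k}"
    and B: "B = {x. \<exists>a. \<forall>k<CARD('n). e (r k) * x $ r k = model_point p q CARD('n) a k + model_offset p q k}"
    by (rule model_coordinates)
  have shift: "{cube s (t + x) | x. x \<in> A} = {cube s x | x. x - t \<in> A}" for s A
  proof safe
    fix x assume "x \<in> A"
    then show "\<exists>y. cube s (t + x) = cube s y \<and> y - t \<in> A" by (intro exI[of _ "t + x"]) simp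
  next
    fix x assume "x - t \<in> A"
    then show "\<exists>y. cube s x = cube s (t + y) \<and> y \<in> A" by (intro exI[of _ "x - t"]) simp
  qed
  have "F = model_cubes p q t e r"
    unfolding F_eq shift model_cubes_def by (simp only: L B mem_Collect_eq)
  from er this show ?thesis by (rule that)
qed

section \<open>Isometries between model tilings\<close>

lemma signed_permutation_isometry:
  fixes \<sigma> :: "'n::finite \<Rightarrow> 'n" and t u :: "real ^ 'n"
  assumes \<sigma>: "bij \<sigma>" and \<delta>: "signs \<delta>"
  defines "f \<equiv> \<lambda>x :: real ^ 'n. \<chi> i. u $ i + \<delta> i * (x - t) $ \<sigma> i"
  shows "dist (f x) (f y) = dist x y" "f ` cube s c = cube s (f c)" "surj f"
proof -
  have diff: "\<bar>f x $ i - f y $ i\<bar> = \<bar>x $ \<sigma> i - y $ \<sigma> i\<bar>" for x y i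
    using signs_abs_diff[OF \<delta>, of i "x $ \<sigma> i - t $ \<sigma> i" "y $ \<sigma> i - t $ \<sigma> i"] by (simp add: f_def)
  have "(\<Sum>i\<in>UNIV. (dist (f x $ i) (f y $ i))\<^sup>2) = (\<Sum>i\<in>UNIV. (dist (x $ \<sigma> i) (y $ \<sigma> i))\<^sup>2)"
    by (simp add: dist_real_def diff)
  also have "\<dots> = (\<Sum>i\<in>UNIV. (dist (x $ i) (y $ i))\<^sup>2)"
    using sum.reindex_bij_betw[OF \<sigma>, of "\<lambda>i. (dist (x $ i) (y $ i))\<^sup>2"] by simp
  finally show "dist (f x) (f y) = dist x y" by (simp add: dist_vec_def L2_set_def)
  have f_inv: "f (\<chi> j. t $ j + \<delta> (inv \<sigma> j) * (y - u) $ inv \<sigma> j) = y" for y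
    using \<sigma> signs_sq[OF \<delta>] by (simp add: f_def vec_eq_iff bij_is_inj flip: mult.assoc)
  then show surj: "surj f" by (rule surjI)
  have mem: "f x \<in> cube s (f c) \<longleftrightarrow> x \<in> cube s c" for x
  proof -
    have "(\<forall>i. P (\<sigma> i)) \<longleftrightarrow> (\<forall>i. P i)" for P using bij_is_surj[OF \<sigma>] by (metis surjD)
    from this[of "\<lambda>i. \<bar>x $ i - c $ i\<bar> \<le> s / 2"] show ?thesis unfolding cube_def mem_Collect_eq diff .
  qed
  show "f ` cube s c = cube s (f c)"
  proof
    show "cube s (f c) \<subseteq> f ` cube s c"
    proof
      fix y assume y: "y \<in> cube s (f c)"
      obtain x where x: "y = f x" using surjD[OF surj] by blast
      with y show "y \<in> f ` cube s c" by (simp add: mem)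
    qed
  qed (auto simp: mem)
qed

lemma model_cubes_isometric:
  fixes e1 e2 :: "'n::finite \<Rightarrow> real"
  assumes e: "signs e1" "signs e2" and r: "bij_betw r1 {..<CARD('n)} UNIV" "bij_betw r2 {..<CARD('n)} UNIV"
  shows "\<exists>f. (\<forall>x y. dist (f x) (f y) = dist x y) \<and>
    (\<lambda>S. f ` S) ` model_cubes p q t1 e1 r1 = model_cubes p q t2 e2 r2"
proof -
  let ?n = "CARD('n)"
  \<comment> \<open>\<open>\<sigma>\<close> takes \<open>r2 k\<close> to \<open>r1 k\<close>, and
    \<open>\<delta>\<close> is the product of the signs there. Hence \<open>f x\<close> has the same
    signed model coordinates in the second model as \<open>x\<close> in the first.\<close>
  define \<sigma> where "\<sigma> = r1 \<circ> inv_into {..<?n} r2"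
  define \<delta> where "\<delta> i = e2 i * e1 (\<sigma> i)" for i
  have \<sigma>: "bij \<sigma>" unfolding \<sigma>_def using r by (intro bij_betw_trans[OF bij_betw_inv_into])
  have \<delta>: "signs \<delta>"
    unfolding signs_def
  proof
    fix i
    have "e2 i = 1 \<or> e2 i = - 1" "e1 (\<sigma> i) = 1 \<or> e1 (\<sigma> i) = - 1" using e by (simp_all only: signs_def)
    then show "\<delta> i = 1 \<or> \<delta> i = - 1" by (auto simp: \<delta>_def)
  qed
  define f where "f = (\<lambda>x :: real ^ 'n. \<chi> i. t2 $ i + \<delta> i * (x - t1) $ \<sigma> i)"
  have f: "dist (f x) (f y) = dist x y" "f ` cube s c = cube s (f c)" "surj f" for x y s c
    unfolding f_def by (rule signed_permutation_isometry[OF \<sigma> \<delta>])+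
  have \<sigma>_r: "\<sigma> (r2 k) = r1 k" if "k < ?n" for k
    using bij_betw_inv_into_left[OF r(2)] that by (simp add: \<sigma>_def)
  have coord: "e2 (r2 k) * (f x - t2) $ r2 k = e1 (r1 k) * (x - t1) $ r1 k" if "k < ?n" for k x
    using signs_sq[OF e(2), of "r2 k"] \<sigma>_r[OF that] by (simp add: f_def \<delta>_def flip: mult.assoc)
  have image: "(\<lambda>S. f ` S) ` {cube s x | x. \<exists>a. \<forall>k<?n. e1 (r1 k) * (x - t1) $ r1 k = Y a k} =
      {cube s x | x. \<exists>a. \<forall>k<?n. e2 (r2 k) * (x - t2) $ r2 k = Y a k}" (is "?l = ?r")
    for s and Y :: "(nat \<Rightarrow> int) \<Rightarrow> nat \<Rightarrow> real"
  proof
    show "?l \<subseteq> ?r"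
    proof clarify
      fix x a assume a: "\<forall>k<?n. e1 (r1 k) * (x - t1) $ r1 k = Y a k"
      have "e2 (r2 k) * (f x - t2) $ r2 k = Y a k" if "k < ?n" for k using a coord[OF that] that by simp
      then show "\<exists>y. f ` cube s x = cube s y \<and> (\<exists>a. \<forall>k<?n. e2 (r2 k) * (y - t2) $ r2 k = Y a k)"
        by (intro exI[of _ "f x"] exI[of _ a] conjI allI impI f(2))
    qed
    show "?r \<subseteq> ?l"
    proof clarify
      fix y a assume a: "\<forall>k<?n. e2 (r2 k) * (y - t2) $ r2 k = Y a k"
      obtain x where x: "y = f x" using surjD[OF f(3)] by blast
      have "\<forall>k<?n. e1 (r1 k) * (x - t1) $ r1 k = Y a k"
      proof (intro allI impI)
        fix k assume k: "k < ?n"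
        then show "e1 (r1 k) * (x - t1) $ r1 k = Y a k" using a coord[OF k, of x] unfolding x by simp
      qed
      then show "cube s y \<in> ?l" unfolding x f(2)[symmetric] by (intro imageI CollectI exI[of _ x] conjI refl) blast
    qed
  qed
  show ?thesis
    by (rule exI[of _ f]) (simp only: f(1) model_cubes_def image_Un image simp_thms)
qed

section \<open>Existence: the model is a lattice tiling\<close>

lemma model_lattice_matrix:
  assumes pq: "0 < p" "p < q" and r: "bij_betw r {..<CARD('n)} (UNIV :: 'n set)"
  shows "\<exists>M :: real ^ 'n ^ 'n. invertible M \<and> (\<forall>z. \<forall>k<CARD('n).
    (M *v z) $ r k = q * z $ r k - p * twisted_shift CARD('n) (\<lambda>j. z $ r j) k)"
proof -
  let ?n = "CARD('n)"
  define G where "G z = (\<chi> i. q * z $ i - p * twisted_shift ?n (\<lambda>j. z $ r j) (inv_into {..<?n} r i))"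
    for z :: "real ^ 'n"
  have G: "G z $ r k = q * z $ r k - p * twisted_shift ?n (\<lambda>j. z $ r j) k" if "k < ?n" for z k
    using bij_betw_inv_into_left[OF r] that by (simp add: G_def)
  have lin: "linear G"
    by (rule linearI) (auto simp: G_def vec_eq_iff twisted_shift_def algebra_simps)
  \<comment> \<open>Strict diagonal dominance: at an entry of maximal absolute value
    \<open>m\<close> the equation gives \<open>q * m \<le> p * m\<close>.\<close>
  have "z = 0" if Gz: "G z = 0" for z
  proof -
    define m where "m = Max (range (\<lambda>i. \<bar>z $ i\<bar>))"
    have m: "\<bar>z $ i\<bar> \<le> m" for i by (simp add: m_def)
    have "m \<in> range (\<lambda>i. \<bar>z $ i\<bar>)" unfolding m_def by (rule Max_in) auto
    then obtain i where i: "m = \<bar>z $ i\<bar>" by blast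
    have "i \<in> r ` {..<?n}" using r by (simp add: bij_betw_def)
    then obtain k where k: "k < ?n" "i = r k" by blast
    have "q * z $ i = p * twisted_shift ?n (\<lambda>j. z $ r j) k" using G[OF k(1), of z] Gz k by simp
    then have "\<bar>q * z $ i\<bar> = \<bar>p * twisted_shift ?n (\<lambda>j. z $ r j) k\<bar>" by (rule arg_cong)
    then have "q * m = p * \<bar>twisted_shift ?n (\<lambda>j. z $ r j) k\<bar>" using pq i by (simp add: abs_mult)
    also have "\<dots> \<le> p * m" using m pq by (intro mult_left_mono) (auto simp: twisted_shift_def)
    finally have "(q - p) * m \<le> 0" by (simp add: algebra_simps)
    then have "m \<le> 0" using pq by (simp add: mult_le_0_iff)
    then have "\<bar>z $ j\<bar> \<le> 0" for j using m[of j] by linarith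
    then show "z = 0" by (simp add: vec_eq_iff)
  qed
  then have "inj G" using lin by (simp add: linear_injective_0)
  then have "det (matrix G) \<noteq> 0" using det_nz_iff_inj[OF lin] by simp
  then have "invertible (matrix G)" by (simp add: invertible_det_nz)
  moreover have "matrix G *v z = G z" for z using fun_cong[OF matrix_vector_mul(2)[OF lin]] .
  ultimately show ?thesis using G by (intro exI[of _ "matrix G"]) simp
qed

lemma model_cubes_tiling:
  fixes r :: "nat \<Rightarrow> 'n::finite"
  assumes pq: "0 < p" "p < q" and r: "bij_betw r {..<CARD('n)} UNIV"
  shows "is_tiling (model_cubes p q 0 (\<lambda>_. 1) r)"
proof -
  let ?n = "CARD('n)"
  define F where "F = model_cubes p q 0 (\<lambda>_. 1) r"
  define P where "P x a = (\<forall>k<?n. x $ r k = model_point p q ?n a k)" for x a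
  define Q where "Q x a = (\<forall>k<?n. x $ r k = model_point p q ?n a k + model_offset p q k)" for x a
  have F: "F = {cube p x | x. \<exists>a. P x a} \<union> {cube q x | x. \<exists>a. Q x a}"
    unfolding F_def model_cubes_def P_def Q_def by simp
  have q: "0 < q" using pq by simp
  have ex_r: "\<exists>k<?n. i = r k" for i
  proof -
    have "i \<in> r ` {..<?n}" using r by (simp add: bij_betw_def)
    then show ?thesis by blast
  qed
  have sep: "\<exists>i. q \<le> \<bar>x $ i - y $ i\<bar>"
    if ab: "\<And>k. k < ?n \<Longrightarrow> x $ r k - y $ r k = model_point p q ?n a k - model_point p q ?n b k"
      and ne: "x \<noteq> y" for x y :: "real ^ 'n" and a b
  proof -
    have sub: "model_point p q ?n (\<lambda>k. a k - b k) k = x $ r k - y $ r k" if "k < ?n" for k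
      using ab[OF that] unfolding model_point_diff by (rule sym)
    obtain i where i: "x $ i \<noteq> y $ i" using ne unfolding vec_eq_iff by blast
    obtain k where "k < ?n" "i = r k" using ex_r by blast
    with i have k: "k < ?n" "x $ r k \<noteq> y $ r k" by simp_all
    \<comment> \<open>Coefficients at indices outside \<open>{..<?n}\<close> are arbitrary, so a
      nonzero difference must be found below \<open>?n\<close>. Coordinate \<open>k\<close> involves
      only the entries at \<open>k\<close>, \<open>k - 1\<close> and \<open>?n - 1\<close>.\<close>
    have "\<exists>k0<?n. a k0 - b k0 \<noteq> 0"
    proof (rule ccontr)
      assume "\<not> ?thesis"
      then have eq: "a j = b j" if "j < ?n" for j using that by auto
      have "a k = b k" "a (k - 1) = b (k - 1)" "a (?n - 1) = b (?n - 1)"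
        by (rule eq, use k(1) in simp)+
      then have "model_point p q ?n a k = model_point p q ?n b k"
        by (simp add: model_point_def twisted_shift_def)
      then show False using ab[OF k(1)] k(2) by simp
    qed
    then obtain k0 where "k0 < ?n" "a k0 - b k0 \<noteq> 0" by blast
    then obtain m where "m < ?n" "q \<le> \<bar>model_point p q ?n (\<lambda>k. a k - b k) m\<bar>"
      using model_point_sep[OF pq, of k0 ?n "\<lambda>k. a k - b k"] by blast
    then show ?thesis using sub by auto
  qed
  have sep_PQ: "\<exists>i. (p + q) / 2 \<le> \<bar>x $ i - y $ i\<bar>" if xy: "P x a" "Q y b" for x y a b
  proof -
    obtain m where m: "m < ?n"
      "(p + q) / 2 \<le> \<bar>model_point p q ?n (\<lambda>k. b k - a k) m + model_offset p q m\<bar>"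
      using model_point_offset_sep[OF pq, of ?n "\<lambda>k. b k - a k"] by auto
    have "model_point p q ?n (\<lambda>k. b k - a k) m = model_point p q ?n b m - model_point p q ?n a m"
      by (rule model_point_diff)
    then have "model_point p q ?n (\<lambda>k. b k - a k) m + model_offset p q m = y $ r m - x $ r m"
      using xy m(1) by (simp add: P_def Q_def)
    then show ?thesis using m(2) by (metis abs_minus_commute)
  qed
  have disj: "negligible (S \<inter> T)" if ST: "S \<in> F" "T \<in> F" "S \<noteq> T" for S T
  proof -
    have PP: "negligible (cube p x \<inter> cube p y)" if "P x a" "P y b" "x \<noteq> y" for x y a b
    proof -
      have "x $ r k - y $ r k = model_point p q ?n a k - model_point p q ?n b k" if "k < ?n" for k
        using \<open>P x a\<close> \<open>P y b\<close> that by (simp add: P_def)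
      from sep[OF this \<open>x \<noteq> y\<close>] obtain i where "q \<le> \<bar>x $ i - y $ i\<bar>" by blast
      then have "(p + p) / 2 \<le> \<bar>x $ i - y $ i\<bar>" using pq by simp
      then show ?thesis using negligible_cube_Int_iff[OF pq(1) pq(1)] by blast
    qed
    have QQ: "negligible (cube q x \<inter> cube q y)" if "Q x a" "Q y b" "x \<noteq> y" for x y a b
    proof -
      have "x $ r k - y $ r k = model_point p q ?n a k - model_point p q ?n b k" if "k < ?n" for k
        using \<open>Q x a\<close> \<open>Q y b\<close> that by (simp add: Q_def)
      from sep[OF this \<open>x \<noteq> y\<close>] obtain i where "q \<le> \<bar>x $ i - y $ i\<bar>" by blast
      then have "(q + q) / 2 \<le> \<bar>x $ i - y $ i\<bar>" by simp
      then show ?thesis using negligible_cube_Int_iff[OF q q] by blast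
    qed
    have PQ: "negligible (cube p x \<inter> cube q y)" if "P x a" "Q y b" for x y a b
      using sep_PQ[OF that] negligible_cube_Int_iff[OF pq(1) q] by blast
    have QP: "negligible (cube q y \<inter> cube p x)" if "P x a" "Q y b" for x y a b
      using PQ[OF that] by (simp add: Int_commute)
    have cases: "(\<exists>x a. S = cube p x \<and> P x a) \<or> (\<exists>x a. S = cube q x \<and> Q x a)" if "S \<in> F" for S
      using that unfolding F by blast
    from cases[OF ST(1)] show ?thesis
    proof (elim disjE exE conjE)
      fix x a assume S: "S = cube p x" "P x a"
      from cases[OF ST(2)] show ?thesis
      proof (elim disjE exE conjE)
        fix y b assume "T = cube p y" "P y b"
        then show ?thesis using PP[of x a y b] S ST(3) by fastforce
      next
        fix y b assume "T = cube q y" "Q y b"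
        then show ?thesis using PQ[of x a y b] S by simp
      qed
    next
      fix x a assume S: "S = cube q x" "Q x a"
      from cases[OF ST(2)] show ?thesis
      proof (elim disjE exE conjE)
        fix y b assume "T = cube p y" "P y b"
        then show ?thesis using QP[of y b x a] S by simp
      next
        fix y b assume "T = cube q y" "Q y b"
        then show ?thesis using QQ[of x a y b] S ST(3) by fastforce
      qed
    qed
  qed
  have cover: "x \<in> \<Union>F" for x
  proof -
    have lift: "\<exists>y. (\<forall>k<?n. y $ r k = Y k) \<and> x \<in> cube s y"
      if Y: "\<And>k. k < ?n \<Longrightarrow> \<bar>x $ r k - Y k\<bar> \<le> s / 2" for Y s
    proof -
      define y where "y = (\<chi> i. Y (inv_into {..<?n} r i))"
      have y: "y $ r k = Y k" if "k < ?n" for k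
        using bij_betw_inv_into_left[OF r] that by (simp add: y_def)
      have "\<bar>x $ i - y $ i\<bar> \<le> s / 2" for i
      proof -
        obtain k where "k < ?n" "i = r k" using ex_r by blast
        then show ?thesis using Y[of k] y[of k] by simp
      qed
      then have "x \<in> cube s y" by (simp add: cube_def)
      then show ?thesis using y by blast
    qed
    show ?thesis
    proof (rule model_cover[OF pq, of ?n "\<lambda>k. x $ r k"])
      fix a assume "\<And>k. k < ?n \<Longrightarrow> \<bar>x $ r k - model_point p q ?n a k\<bar> \<le> p / 2"
      from lift[OF this] obtain y where "P y a" "x \<in> cube p y" unfolding P_def by blast
      then show ?thesis unfolding F by blast
    next
      fix a assume "\<And>k. k < ?n \<Longrightarrow> \<bar>x $ r k - (model_point p q ?n a k + model_offset p q k)\<bar> \<le> q / 2"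
      from lift[OF this] obtain y where "Q y a" "x \<in> cube q y" unfolding Q_def by blast
      then show ?thesis unfolding F by blast
    qed simp
  qed
  have "closed S" if "S \<in> F" for S using that unfolding F by (auto simp: closed_cube)
  moreover have "\<Union>F = UNIV" using cover by (intro UNIV_eq_I[symmetric])
  ultimately show ?thesis unfolding is_tiling_def F_def[symmetric] by (simp add: disj)
qed

lemma model_cubes_lattice_cube_tiling:
  fixes r :: "nat \<Rightarrow> 'n::finite"
  assumes pq: "0 < p" "p < q" and r: "bij_betw r {..<CARD('n)} UNIV"
  shows "lattice_cube_tiling p q (model_cubes p q 0 (\<lambda>_. 1) r)"
proof -
  let ?n = "CARD('n)"
  obtain M :: "real ^ 'n ^ 'n" where M: "invertible M"
    "\<And>z k. k < ?n \<Longrightarrow> (M *v z) $ r k = q * z $ r k - p * twisted_shift ?n (\<lambda>j. z $ r j) k"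
    using model_lattice_matrix[OF pq r] by metis
  define b :: "real ^ 'n" where "b = (\<chi> i. model_offset p q (inv_into {..<?n} r i))"
  have b: "b $ r k = model_offset p q k" if "k < ?n" for k
    using bij_betw_inv_into_left[OF r] that by (simp add: b_def)
  have ex_r: "\<exists>k<?n. i = r k" for i
  proof -
    have "i \<in> r ` {..<?n}" using r by (simp add: bij_betw_def)
    then show ?thesis by blast
  qed
  have lattice: "l \<in> lattice_of M \<longleftrightarrow> (\<exists>a. \<forall>k<?n. l $ r k = model_point p q ?n a k)" for l
  proof
    assume "l \<in> lattice_of M"
    then obtain z where z: "l = M *v z" "\<And>i. z $ i \<in> \<int>" by (auto simp: lattice_of_def)
    define a where "a k = \<lfloor>z $ r k\<rfloor>" for k
    have "real_of_int (a k) = z $ r k" for k using z(2) by (simp add: a_def)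
    then have "l $ r k = model_point p q ?n a k" if "k < ?n" for k
      using M(2)[OF that] by (simp add: z model_point_def twisted_shift_def)
    then show "\<exists>a. \<forall>k<?n. l $ r k = model_point p q ?n a k" by blast
  next
    assume "\<exists>a. \<forall>k<?n. l $ r k = model_point p q ?n a k"
    then obtain a where a: "\<And>k. k < ?n \<Longrightarrow> l $ r k = model_point p q ?n a k" by blast
    define z :: "real ^ 'n" where "z = (\<chi> i. a (inv_into {..<?n} r i))"
    have z: "z $ r k = a k" if "k < ?n" for k
      using bij_betw_inv_into_left[OF r] that by (simp add: z_def)
    have "l = M *v z"
    proof (rule vec_eq_iff[THEN iffD2], intro allI)
      fix i obtain k where k: "k < ?n" "i = r k" using ex_r by blast
      then show "l $ i = (M *v z) $ i"
        using a[OF k(1)] M(2)[OF k(1), of z] z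
        by (simp add: model_point_def twisted_shift_def less_imp_diff_less)
    qed
    moreover have "\<forall>i. z $ i \<in> \<int>" by (simp add: z_def)
    ultimately show "l \<in> lattice_of M" unfolding lattice_of_def by blast
  qed
  have small: "{(\<lambda>x. x + l) ` cube p 0 | l. l \<in> lattice_of M} =
      {cube p x | x. \<exists>a. \<forall>k<?n. 1 * (x - 0) $ r k = model_point p q ?n a k}"
    unfolding translation_cube lattice by simp
  have big: "{(\<lambda>x. x + l) ` cube q b | l. l \<in> lattice_of M} =
      {cube q x | x. \<exists>a. \<forall>k<?n. 1 * (x - 0) $ r k = model_point p q ?n a k + model_offset p q k}"
    unfolding translation_cube lattice
  proof safe
    fix l a assume "\<forall>k<?n. l $ r k = model_point p q ?n a k"
    then have "\<forall>k<?n. 1 * (b + l - 0) $ r k = model_point p q ?n a k + model_offset p q k" using b by simp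
    then show "\<exists>x. cube q (b + l) = cube q x \<and>
        (\<exists>a. \<forall>k<?n. 1 * (x - 0) $ r k = model_point p q ?n a k + model_offset p q k)" by blast
  next
    fix x a assume "\<forall>k<?n. 1 * (x - 0) $ r k = model_point p q ?n a k + model_offset p q k"
    then have "\<forall>k<?n. (x - b) $ r k = model_point p q ?n a k" using b by simp
    moreover have "cube q x = cube q (b + (x - b))" by simp
    ultimately show "\<exists>l. cube q x = cube q (b + l) \<and> (\<exists>a. \<forall>k<?n. l $ r k = model_point p q ?n a k)"
      by blast
  qed
  have "is_hcube p (cube p 0)" "is_hcube q (cube q b)" using pq by (auto simp: is_hcube_iff)
  moreover have "model_cubes p q 0 (\<lambda>_. 1) r =
      {(\<lambda>x. x + l) ` cube p 0 | l. l \<in> lattice_of M} \<union> {(\<lambda>x. x + l) ` cube q b | l. l \<in> lattice_of M}"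
    unfolding model_cubes_def small big ..
  ultimately show ?thesis
    unfolding lattice_cube_tiling_def using M(1) model_cubes_tiling[OF pq r]
    by (intro exI[of _ M] exI[of _ "cube p 0"] exI[of _ "cube q b"] conjI)
qed

section \<open>Symmetry in the two side lengths and conclusion\<close>

lemma lattice_cube_tiling_commute:
  "lattice_cube_tiling p q F \<longleftrightarrow> lattice_cube_tiling q p F"
proof -
  have swap: "P1 \<and> P2 \<and> P3 \<and> F = X \<union> Y \<and> P4 \<longleftrightarrow> P1 \<and> P3 \<and> P2 \<and> F = Y \<union> X \<and> P4"
    for P1 P2 P3 P4 and X Y :: "(real ^ 'a) set set"
    by (simp only: Un_commute conj_ac)
  show ?thesis
    unfolding lattice_cube_tiling_def by (rule ex_cong1, subst ex_comm, intro ex_cong1, rule swap)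
qed

lemma unilateral_tiling_unique_less:
  fixes p q :: real
  assumes pq: "0 < p" "p < q"
  shows "(\<exists>F :: (real ^ 'n) set set. lattice_cube_tiling p q F \<and> unilateral F) \<and>
         (\<forall>F1 F2 :: (real ^ 'n) set set.
            lattice_cube_tiling p q F1 \<and> unilateral F1 \<and> lattice_cube_tiling p q F2 \<and> unilateral F2 \<longrightarrow>
            (\<exists>f :: real ^ 'n \<Rightarrow> real ^ 'n. (\<forall>x y. dist (f x) (f y) = dist x y) \<and>
               (\<lambda>S. f ` S) ` F1 = F2))"
proof (intro conjI allI impI)
  obtain r where "bij_betw r {..<CARD('n)} (UNIV :: 'n set)"
    using ex_bij_betw_nat_finite[of "UNIV :: 'n set"] by (auto simp: atLeast0LessThan)
  then have "lattice_cube_tiling p q (model_cubes p q (0 :: real ^ 'n) (\<lambda>_. 1) r)"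
    by (rule model_cubes_lattice_cube_tiling[OF pq])
  then show "\<exists>F :: (real ^ 'n) set set. lattice_cube_tiling p q F \<and> unilateral F"
    using lattice_cube_tiling_unilateral[OF _ pq] by blast
next
  fix F1 F2 :: "(real ^ 'n) set set"
  assume F: "lattice_cube_tiling p q F1 \<and> unilateral F1 \<and> lattice_cube_tiling p q F2 \<and> unilateral F2"
  obtain t1 e1 r1 where 1: "signs e1" "bij_betw r1 {..<CARD('n)} UNIV" "F1 = model_cubes p q t1 e1 r1"
    using lattice_cube_tiling_eq_model[OF _ pq, of F1] F by blast
  obtain t2 e2 r2 where 2: "signs e2" "bij_betw r2 {..<CARD('n)} UNIV" "F2 = model_cubes p q t2 e2 r2"
    using lattice_cube_tiling_eq_model[OF _ pq, of F2] F by blast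
  show "\<exists>f :: real ^ 'n \<Rightarrow> real ^ 'n. (\<forall>x y. dist (f x) (f y) = dist x y) \<and> (\<lambda>S. f ` S) ` F1 = F2"
    unfolding 1 2 by (rule model_cubes_isometric[OF 1(1) 2(1) 1(2) 2(2)])
qed

theorem theorem1:
  fixes p q :: real
  assumes "CARD('n) \<ge> 2" and "p > 0" and "q > 0" and "p \<noteq> q"
  shows "(\<exists>F :: (real ^ 'n) set set. lattice_cube_tiling p q F \<and> unilateral F) \<and>
         (\<forall>F1 F2 :: (real ^ 'n) set set.
            lattice_cube_tiling p q F1 \<and> unilateral F1 \<and> lattice_cube_tiling p q F2 \<and> unilateral F2 \<longrightarrow>
            (\<exists>f :: real ^ 'n \<Rightarrow> real ^ 'n. (\<forall>x y. dist (f x) (f y) = dist x y) \<and>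
               (\<lambda>S. f ` S) ` F1 = F2))"
proof (cases "p < q")
  case True
  with assms(2) show ?thesis by (rule unilateral_tiling_unique_less)
next
  case False
  then have "q < p" using assms by simp
  \<comment> \<open>Exchanging the roles of \<open>S0\<close> and \<open>T0\<close> reduces this
    case to the one already settled.\<close>
  have eq: "lattice_cube_tiling p q = (lattice_cube_tiling q p :: (real ^ 'n) set set \<Rightarrow> bool)"
    using lattice_cube_tiling_commute by blast
  show ?thesis
    unfolding eq by (rule unilateral_tiling_unique_less[OF assms(3) \<open>q < p\<close>])
qed

end
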